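(* Let $(\mathcal T(n))_{n\in\mathbb N}$ be the triangle Markov chain obtained by iterated random barycentric subdivision started from an arbitrary triangle, and for each $n$ let $A_n$ be the largest angle of $\mathcal T(n)$, i.e. the angle at the vertex $(X_n,Y_n)$ of its normalized form, between the segments $[(X_n,Y_n),(0,0)]$ and $[(X_n,Y_n),(1,0)]$, where $(X_n,Y_n)$ is the characterizing point of $\mathcal T(n)$. Then for every $\epsilon>0$, $$\lim_{n\to\infty}\mathbb P[A_n<\pi-\epsilon]=0 .$$
   Context: A triangle is given by three points of the plane which are not all equal. Barycentric subdivision: if a triangle has vertices $A,B,C$, let $D,E,F$ be the midpoints of $[A,B],[B,C],[C,A]$ and $G$ its barycenter; the medians cut it into the six triangles $\{A,D,G\},\{D,B,G\},\{B,E,G\},\{E,C,G\},\{C,F,G\},\{F,A,G\}$. The triangle Markov chain: $\mathcal T(0)$ is given and $\mathcal T(n+1)$ is chosen uniformly among the six triangles of the barycentric subdivision of $\mathcal T(n)$, independently of the past. Characterizing point: there is a similitude mapping the triangle onto a triangle with vertices $(0,0)$, $(1,0)$, $(x,y)$, $0\le x\le1/2$, $y\ge0$, sending its longest edge onto $[(0,0),(1,0)]$ and its shortest edge onto $[(0,0),(x,y)]$; $(x,y)$ is unique and is the characterizing point; this image triangle is the normalized form. *)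

theory Defs
  imports "HOL-Probability.Probability"
begin

type_synonym triangle = "complex \<times> complex \<times> complex"

definition nondeg_triangle :: "triangle \<Rightarrow> bool" where
  "nondeg_triangle T = (case T of (A, B, C) \<Rightarrow> \<not> (A = B \<and> B = C))"

definition bary_child :: "triangle \<Rightarrow> nat \<Rightarrow> triangle" where
  "bary_child T i = (case T of (A, B, C) \<Rightarrow>
     (let D = (A + B) / 2; E = (B + C) / 2; F = (C + A) / 2; G = (A + B + C) / 3 in
      if i = 0 then (A, D, G) else if i = 1 then (D, B, G) else if i = 2 then (B, E, G)
      else if i = 3 then (E, C, G) else if i = 4 then (C, F, G) else (F, A, G)))"

definition bary_step :: "triangle \<Rightarrow> triangle pmf" where
  "bary_step T = map_pmf (bary_child T) (pmf_of_set {0..<6})"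

primrec tri_chain :: "triangle \<Rightarrow> nat \<Rightarrow> triangle pmf" where
  "tri_chain T0 0 = return_pmf T0"
| "tri_chain T0 (Suc n) = bind_pmf (tri_chain T0 n) bary_step"

definition similitude :: "(complex \<Rightarrow> complex) \<Rightarrow> bool" where
  "similitude f = (\<exists>a b. a \<noteq> 0 \<and> ((\<forall>z. f z = a * z + b) \<or> (\<forall>z. f z = a * cnj z + b)))"

definition is_char_point :: "triangle \<Rightarrow> complex \<Rightarrow> bool" where
  "is_char_point T p = (0 \<le> Re p \<and> Re p \<le> 1/2 \<and> 0 \<le> Im p \<and>
     (\<exists>P Q R f. (case T of (A, B, C) \<Rightarrow>
          (P, Q, R) \<in> {(A, B, C), (A, C, B), (B, A, C), (B, C, A), (C, A, B), (C, B, A)}) \<and>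
        dist P Q \<ge> dist Q R \<and> dist Q R \<ge> dist P R \<and>
        similitude f \<and> f P = 0 \<and> f Q = 1 \<and> f R = p))"

definition char_point :: "triangle \<Rightarrow> complex" where
  "char_point T = (THE p. is_char_point T p)"

definition vertex_angle :: "complex \<Rightarrow> complex \<Rightarrow> complex \<Rightarrow> real" where
  "vertex_angle v u w =
     arccos (((u - v) \<bullet> (w - v)) / (norm (u - v) * norm (w - v)))"

definition largest_angle :: "triangle \<Rightarrow> real" where
  "largest_angle T = vertex_angle (char_point T) 0 1"

end

theory Submission
  imports Defs
begin

text \<open>
  An edge of the triangle at time n is an integer combination of the vertices of the initial
  triangle, divided by 6 to the power n, and the coefficient vector w of an edge performs a random
  walk: a permutation of the coordinates followed by a fixed linear map. The six permutations are
  isometries of the quadratic form N of sum-zero vectors. Relative to the determinant, the product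
  of the six possible growth factors of N is at least 9/4, so by a second-order expansion a small
  negative power of the normalised N contracts in expectation. The angle can only stay away
  from \<open>\<pi>\<close> if some squared edge is at most a constant times the area, and the area at time n is
  deterministic. For a triangle of positive area this makes the probability decay geometrically.

  If the initial triangle is flat, the only obstruction is that two vertices coincide, i.e. that the
  coefficient vector lies on one fixed rational line. Then the same contraction is applied to
  the projective height N(w) / gcd(w)^2, which is constant on that line: the gcd of the image of a
  primitive vector divides 6 and picks up the factor 2 for only two, and the factor 3 for at most
  two, of the six permutations.
\<close>

section \<open>The walk of edge coefficients\<close>

fun comb :: "int \<times> int \<times> int \<Rightarrow> triangle \<Rightarrow> complex" where
  "comb (a, b, c) (A, B, C) = of_int a * A + of_int b * B + of_int c * C"

text \<open>
  The coefficients, scaled by 6, with respect to a triangle of a combination of the vertices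
  of its first child.
\<close>

fun refine :: "int \<times> int \<times> int \<Rightarrow> int \<times> int \<times> int" where
  "refine (a, b, c) = (6 * a + 3 * b + 2 * c, 3 * b + 2 * c, 2 * c)"

text \<open>Summing over all permutations of the coefficients removes the dependence on the order in
  which \<open>bary_child\<close> lists the vertices.\<close>

fun sym6 :: "('a \<times> 'a \<times> 'a \<Rightarrow> real) \<Rightarrow> 'a \<times> 'a \<times> 'a \<Rightarrow> real" where
  "sym6 F (a, b, c) =
     F (a, b, c) + F (a, c, b) + F (b, a, c) + F (b, c, a) + F (c, a, b) + F (c, b, a)"

text \<open>The nonzero vectors of the sum-zero lattice, whose combinations ignore translations; the
  edges are among them. Two coordinates suffice for nonvanishing because they determine the
  third.\<close>

fun weights :: "int \<times> int \<times> int \<Rightarrow> bool" where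
  "weights (a, b, c) \<longleftrightarrow> a + b + c = 0 \<and> (a \<noteq> 0 \<or> b \<noteq> 0)"

fun sqnorm :: "int \<times> int \<times> int \<Rightarrow> int" where
  "sqnorm (a, b, c) = a\<^sup>2 + b\<^sup>2 + c\<^sup>2"

text \<open>For coefficients with sum zero this is also the gcd of all three.\<close>

fun content :: "int \<times> int \<times> int \<Rightarrow> int" where
  "content (a, b, c) = gcd a b"

section \<open>Trading the choice of a child for a permutation of the coefficients\<close>

lemma sym6_comb_swap:
  "sym6 (\<lambda>w. h (comb w (B, A, C))) w = sym6 (\<lambda>w. h (comb w (A, B, C))) w"
  by (cases w; simp add: algebra_simps)

lemma comb_bary_child_0: "6 * comb w (bary_child T 0) = comb (refine w) T"
  by (cases w; cases T; simp add: bary_child_def Let_def field_simps)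

lemma sym6_bary_child_0:
  "sym6 (\<lambda>w. h (6 * comb w (bary_child T 0))) w = sym6 (\<lambda>w. h (comb (refine w) T)) w"
  unfolding comb_bary_child_0 ..

text \<open>
  The children depend on the order of the vertices only up to relabelling, so summing over all
  relabellings moves the choice of the child to a permutation of the coefficients.
\<close>

lemma sym6_children:
  "(\<Sum>i<6. sym6 (\<lambda>w. h (6 * comb w (bary_child T i))) w)
     = sym6 (\<lambda>v. sym6 (\<lambda>w. h (comb w T)) (refine v)) w"
proof -
  obtain A B C where T: "T = (A, B, C)" by (cases T)
  let ?S = "\<lambda>T. sym6 (\<lambda>w. h (6 * comb w T)) w"
  let ?R = "\<lambda>T. sym6 (\<lambda>w. h (comb (refine w) T)) w"
  note swap = sym6_comb_swap[where h = "\<lambda>z. h (6 * z)"]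
  have c: "bary_child (A, B, C) 0 = (A, (A + B) / 2, (A + B + C) / 3)" for A B C
    by (simp add: bary_child_def Let_def)
  have R: "?S (A, (A + B) / 2, (A + B + C) / 3) = ?R (A, B, C)" for A B C
    using sym6_bary_child_0[of h "(A, B, C)" w] by (simp only: c)
  have 0: "?S (bary_child T 0) = ?R (A, B, C)"
    by (simp only: T c R)
  \<comment> \<open>Children of odd index list the midpoint before the vertex. Swapping these two,
    which \<open>sym6\<close> does not notice, makes them first children of a relabelled parent. The
    even ones need no swap.\<close>
  have 1: "?S (bary_child T 1) = ?R (B, A, C)"
    using swap[of B "(A + B) / 2" "(A + B + C) / 3" w] R[of B A C]
    by (simp only: T bary_child_def Let_def) (simp add: add_ac)
  have 2: "?S (bary_child T 2) = ?R (B, C, A)"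
    using R[of B C A]
    by (simp only: T bary_child_def Let_def) (simp add: add_ac)
  have 3: "?S (bary_child T 3) = ?R (C, B, A)"
    using swap[of C "(B + C) / 2" "(A + B + C) / 3" w] R[of C B A]
    by (simp only: T bary_child_def Let_def) (simp add: add_ac)
  have 4: "?S (bary_child T 4) = ?R (C, A, B)"
    using R[of C A B]
    by (simp only: T bary_child_def Let_def) (simp add: add_ac)
  have 5: "?S (bary_child T 5) = ?R (A, C, B)"
    using swap[of A "(C + A) / 2" "(A + B + C) / 3" w] R[of A C B]
    by (simp only: T bary_child_def Let_def) (simp add: add_ac)
  have sum6: "(\<Sum>i<6. f i) = f 0 + f 1 + f 2 + f 3 + f 4 + f 5" for f :: "nat \<Rightarrow> real"
    by (simp add: eval_nat_numeral)
  obtain a b c where w: "w = (a, b, c)" by (cases w)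
  \<comment> \<open>The parents that arise are the six relabellings of \<open>T\<close>, and
    relabelling the triangle amounts to permuting the coefficients.\<close>
  have eq: "h (comb (refine v) (B, A, C)) + h (comb (refine v) (A, B, C)) + h (comb (refine v) (B, C, A))
    + h (comb (refine v) (C, B, A)) + h (comb (refine v) (C, A, B)) + h (comb (refine v) (A, C, B))
    = sym6 (\<lambda>w. h (comb w T)) (refine v)" for v
    by (cases "refine v") (simp only: T sym6.simps comb.simps add_ac)
  show ?thesis
    unfolding sum6 0 1 2 3 4 5 unfolding w sym6.simps eq[symmetric] by (simp only: add_ac)
qed

lemma finite_set_tri_chain: "finite (set_pmf (tri_chain T n))"
  by (induction n) (auto simp: bary_step_def set_pmf_of_set)

lemma expectation_bary_step:
  "measure_pmf.expectation (bary_step T) f = (\<Sum>i<6. f (bary_child T i)) / (6 :: real)"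
  by (simp add: bary_step_def integral_pmf_of_set lessThan_atLeast0)

lemma expectation_tri_chain_Suc:
  fixes f :: "triangle \<Rightarrow> real"
  shows "measure_pmf.expectation (tri_chain T (Suc n)) f
     = measure_pmf.expectation (tri_chain T n) (\<lambda>U. (\<Sum>i<6. f (bary_child U i)) / 6)"
proof -
  have fin: "finite (set_pmf (bary_step U))" for U
    by (simp add: bary_step_def)
  show ?thesis
    unfolding tri_chain.simps
    by (subst pmf_expectation_bind[OF finite_set_tri_chain fin subset_refl])
       (simp add: expectation_bary_step integral_measure_pmf[OF finite_set_tri_chain]
         flip: sum_divide_distrib)
qed

lemma weights_refine: "weights w \<Longrightarrow> weights (refine w)"
  by (cases w) auto

text \<open>A Lyapunov bound in which \<open>V\<close> is the Lyapunov function. The last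
  subdivision is absorbed into the coefficients by \<open>sym6_children\<close>, so the walk
  consumes the steps of the chain from last to first and meets the fixed triangle \<open>T\<close>
  only at the end, through \<open>base\<close>.\<close>

lemma expectation_tri_chain_sym6_le:
  fixes V :: "int \<times> int \<times> int \<Rightarrow> real"
  assumes step: "\<And>w. weights w \<Longrightarrow> sym6 (\<lambda>v. V (refine v)) w \<le> 6 * \<rho> * V w"
    and base: "\<And>w. weights w \<Longrightarrow> sym6 (\<lambda>v. h (comb v T)) w \<le> C * V w"
    and nonneg: "0 \<le> C" "0 \<le> \<rho>"
    and w: "weights w"
  shows "measure_pmf.expectation (tri_chain T n) (\<lambda>U. sym6 (\<lambda>v. h (6 ^ n * comb v U)) w)
           \<le> C * \<rho> ^ n * V w"
  using w
proof (induction n arbitrary: w)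
  case 0
  then show ?case using base by simp
next
  case (Suc n)
  let ?E = "\<lambda>f. measure_pmf.expectation (tri_chain T n) f"
  let ?S = "\<lambda>w U. sym6 (\<lambda>v. h (6 ^ n * comb v U)) w"
  have int: "integrable (measure_pmf (tri_chain T n)) f" for f :: "triangle \<Rightarrow> real"
    by (rule integrable_measure_pmf_finite[OF finite_set_tri_chain])
  have E_sym6: "?E (\<lambda>U. sym6 (\<lambda>v. F v U) w / 6) = sym6 (\<lambda>v. ?E (F v)) w / 6"
    for F :: "int \<times> int \<times> int \<Rightarrow> triangle \<Rightarrow> real"
    by (cases w) (simp add: int)
  have "measure_pmf.expectation (tri_chain T (Suc n)) (\<lambda>U. sym6 (\<lambda>v. h (6 ^ Suc n * comb v U)) w)
      = ?E (\<lambda>U. sym6 (\<lambda>v. ?S (refine v) U) w / 6)"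
    unfolding expectation_tri_chain_Suc
      sym6_children[where h = "\<lambda>z. h (6 ^ n * z)", symmetric] by (simp add: mult_ac)
  also have "\<dots> = sym6 (\<lambda>v. ?E (?S (refine v))) w / 6"
    by (rule E_sym6)
  also have "\<dots> \<le> sym6 (\<lambda>v. C * \<rho> ^ n * V (refine v)) w / 6"
  proof -
    obtain a b c where "w = (a, b, c)" by (cases w)
    then show ?thesis
      using Suc.prems
      by (auto simp del: refine.simps simp: sym6.simps[of "\<lambda>v. _ (refine v)"]
          intro!: divide_right_mono add_mono Suc.IH weights_refine)
  qed
  also have "\<dots> = C * \<rho> ^ n * (sym6 (\<lambda>v. V (refine v)) w / 6)"
    by (cases w) (simp add: algebra_simps add_divide_distrib)
  also have "\<dots> \<le> C * \<rho> ^ n * (\<rho> * V w)"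
    using step[OF Suc.prems] nonneg by (intro mult_left_mono) auto
  finally show ?case by (simp add: mult_ac)
qed

section \<open>Growth of the quadratic form under refinement\<close>

lemma sqnorm_pos: "weights w \<Longrightarrow> 0 < sqnorm w"
  by (cases w) (auto simp: add_pos_nonneg add_nonneg_pos)

text \<open>The factor 6 is the determinant of \<open>refine\<close> on the sum-zero plane; the
  remaining form has the same discriminant there as \<open>sqnorm\<close>.\<close>

lemma sqnorm_refine:
  "a + b + c = 0 \<Longrightarrow> sqnorm (refine (a, b, c)) = 6 * (3 * a\<^sup>2 + c\<^sup>2)"
proof -
  assume "a + b + c = 0"
  then have c: "c = - a - b" by simp
  show ?thesis by (simp add: c power2_eq_square algebra_simps)
qed

lemma sqnorm_refine_bounds:
  assumes "weights w"
  shows "2 * sqnorm w \<le> sqnorm (refine w)" "sqnorm (refine w) \<le> 18 * sqnorm w"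
proof -
  obtain a b c where w: "w = (a, b, c)" by (cases w)
  have s: "a + b + c = 0" using assms w by simp
  then have b: "b = - a - c" by simp
  have "b\<^sup>2 \<le> 2 * a\<^sup>2 + 2 * c\<^sup>2"
    using zero_le_power2[of "a - c"] by (simp add: b power2_eq_square algebra_simps)
  moreover have "2 * (x + y + z) \<le> 6 * (3 * x + z)" if "y \<le> 2 * x + 2 * z" "0 \<le> x" for x y z :: int
    using that by presburger
  ultimately show "2 * sqnorm w \<le> sqnorm (refine w)"
    unfolding w sqnorm_refine[OF s] sqnorm.simps by (metis zero_le_power2)
  show "sqnorm (refine w) \<le> 18 * sqnorm w"
    unfolding w sqnorm_refine[OF s] by simp
qed

text \<open>The product is symmetric of degree 12, so for a + b + c = 0 it is a combination of q^6,
  q^3 (abc)^2 and (abc)^4. All three coefficients are positive, and the term q^6 alone yields the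
  constant 9/4.\<close>

lemma prod_sqnorm_refine:
  assumes "a + b + c = 0"
  shows "(9::int) * (sqnorm (a, b, c)) ^ 6 \<le> 4 *
    ((3 * a\<^sup>2 + c\<^sup>2) * (3 * a\<^sup>2 + b\<^sup>2) * (3 * b\<^sup>2 + c\<^sup>2) * (3 * b\<^sup>2 + a\<^sup>2) * (3 * c\<^sup>2 + b\<^sup>2) * (3 * c\<^sup>2 + a\<^sup>2))"
    (is "_ \<le> 4 * ?P")
proof -
  define q where "q = a\<^sup>2 + a * b + b\<^sup>2"
  have c: "c = - a - b" using assms by simp
  have q: "2 * q = a\<^sup>2 + b\<^sup>2 + c\<^sup>2"
    by (simp add: q_def c power2_eq_square algebra_simps)
  have "0 \<le> q" using q by (smt (verit) zero_le_power2)
  have "?P = 144 * q ^ 6 + 204 * q ^ 3 * (a * b * c)\<^sup>2 + 343 * (a * b * c) ^ 4"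
    unfolding q_def c by algebra
  also have "\<dots> \<ge> 144 * q ^ 6"
    using \<open>0 \<le> q\<close> by simp
  finally have "144 * q ^ 6 \<le> ?P" .
  moreover have "9 * (sqnorm (a, b, c)) ^ 6 = 4 * (144 * q ^ 6)"
    by (simp add: q[symmetric] power_mult_distrib)
  ultimately show ?thesis by linarith
qed

section \<open>Contraction of negative powers\<close>

lemma exp_minus_le_quadratic:
  fixes t :: real
  assumes "\<bar>t\<bar> \<le> 1/2"
  shows "exp (- t) \<le> 1 - t + 2 * t\<^sup>2"
proof -
  have pos: "0 < 1 + t" using assms by linarith
  have "exp (- t) \<le> 1 / (1 + t)"
    using exp_ge_add_one_self[of t] pos by (simp add: exp_minus field_simps)
  also have "\<dots> \<le> 1 - t + 2 * t\<^sup>2"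
  proof -
    have "0 \<le> t\<^sup>2 * (1 + 2 * t)" using assms by (intro mult_nonneg_nonneg) auto
    then show ?thesis using pos by (simp add: field_simps power2_eq_square)
  qed
  finally show ?thesis .
qed

text \<open>Expanding each power as an exponential, the first-order terms add up to the logarithm of
  the product, while the second-order terms are bounded uniformly through \<open>K\<close>.\<close>

lemma sum_list_powr_neg_le:
  fixes K s :: real
  assumes K: "1 < K" and s: "0 < s" "s * ln K \<le> 1/2"
    and ys: "\<And>y. y \<in> set ys \<Longrightarrow> 1 / K \<le> y \<and> y \<le> K"
  shows "0 < prod_list ys \<and> (\<Sum>y\<leftarrow>ys. y powr - s)
    \<le> real (length ys) * (1 + 2 * (s * ln K)\<^sup>2) - s * ln (prod_list ys)"
  using ys
proof (induction ys)
  case Nil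
  then show ?case by simp
next
  case (Cons y ys)
  have y: "1 / K \<le> y" "y \<le> K" using Cons.prems by auto
  have y0: "0 < y" using y(1) K by (smt (verit) zero_less_divide_1_iff)
  have "ln (1 / K) \<le> ln y" "ln y \<le> ln K"
    using y y0 K by auto
  then have ln: "\<bar>ln y\<bar> \<le> ln K" using K by (simp add: ln_div abs_le_iff)
  have sl: "\<bar>s * ln y\<bar> \<le> s * ln K"
    using ln s(1) by (simp add: abs_mult)
  have "y powr - s = exp (- (s * ln y))" using y0 by (simp add: powr_def)
  also have "\<dots> \<le> 1 - s * ln y + 2 * (s * ln y)\<^sup>2"
    by (rule exp_minus_le_quadratic) (use sl s in linarith)
  also have "(s * ln y)\<^sup>2 \<le> (s * ln K)\<^sup>2"
    using sl by (metis abs_ge_zero power2_abs power_mono)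
  finally have 1: "y powr - s \<le> 1 - s * ln y + 2 * (s * ln K)\<^sup>2" by simp
  have IH: "0 < prod_list ys" "(\<Sum>y\<leftarrow>ys. y powr - s)
    \<le> real (length ys) * (1 + 2 * (s * ln K)\<^sup>2) - s * ln (prod_list ys)"
    using Cons by auto
  have "ln (y * prod_list ys) = ln y + ln (prod_list ys)"
    using y0 IH(1) by (simp add: ln_mult)
  then show ?case using 1 IH y0 by (simp add: algebra_simps)
qed

text \<open>For small \<open>s\<close> the first-order gain s ln (9/4) outweighs the second-order
  loss 12 (s ln K)^2. Both \<open>s\<close> and \<open>\<rho>\<close> depend on \<open>K\<close>
  only, which makes the contraction uniform in the weight vector.\<close>

lemma powr_neg_drift:
  fixes K :: real
  assumes K: "1 < K"
  obtains s \<rho> :: real where "0 < s" "0 \<le> \<rho>" "\<rho> < 1"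
    "\<And>ys. \<lbrakk>\<And>y. y \<in> set ys \<Longrightarrow> 1 / K \<le> y \<and> y \<le> K; length ys = 6; 9/4 \<le> prod_list ys\<rbrakk>
       \<Longrightarrow> (\<Sum>y\<leftarrow>ys. y powr - s) \<le> 6 * \<rho>"
proof -
  define \<delta> where "\<delta> = min 1 (ln (9/4 :: real))"
  define L where "L = max 1 (ln K)"
  \<comment> \<open>With this \<open>s\<close> the loss is at most half of the gain s \<delta>; the
    other half, shared by six terms, gives \<open>\<rho>\<close>. The caps by 1 in
    \<open>\<delta>\<close> and \<open>L\<close> keep s ln K below 1/2 and \<open>\<rho>\<close>
    nonnegative.\<close>
  define s where "s = \<delta> / (24 * L\<^sup>2)"
  define \<rho> where "\<rho> = 1 - s * \<delta> / 12"
  have \<delta>: "0 < \<delta>" "\<delta> \<le> 1" "\<delta> \<le> ln (9/4)" by (auto simp: \<delta>_def)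
  have L: "1 \<le> L" "ln K \<le> L" by (auto simp: L_def)
  have L2: "L \<le> L\<^sup>2" using L(1) by (simp add: power2_eq_square)
  have s: "0 < s" using \<delta> L by (simp add: s_def)
  have sL2: "s * (24 * L\<^sup>2) = \<delta>" using L by (simp add: s_def)
  have "s * (24 * L) \<le> s * (24 * L\<^sup>2)" using s L2 by (intro mult_left_mono) auto
  then have sL: "s * L \<le> 1/24" using sL2 \<delta> by simp
  have "s * 1 \<le> s * L" using s L by (intro mult_left_mono) auto
  then have s1: "s \<le> 1/24" using sL by simp
  have slnK: "s * ln K \<le> s * L" using s L by simp
  have "0 \<le> s * ln K" using s K by simp
  then have "(s * ln K)\<^sup>2 \<le> (s * L)\<^sup>2" using slnK by (intro power_mono)
  also have "\<dots> = s * (s * (24 * L\<^sup>2)) / 24" by (simp add: power2_eq_square)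
  finally have sq: "24 * (s * ln K)\<^sup>2 \<le> s * \<delta>" by (simp add: sL2)
  have "s * \<delta> \<le> 1 * 1" using s s1 \<delta> by (intro mult_mono) auto
  then have \<rho>: "0 \<le> \<rho>" "\<rho> < 1" using s \<delta> by (auto simp: \<rho>_def)
  show thesis
  proof (rule that[OF s \<rho>])
    fix ys :: "real list"
    assume ys: "\<And>y. y \<in> set ys \<Longrightarrow> 1 / K \<le> y \<and> y \<le> K" and len: "length ys = 6"
      and prod: "9/4 \<le> prod_list ys"
    have "(\<Sum>y\<leftarrow>ys. y powr - s) \<le> 6 * (1 + 2 * (s * ln K)\<^sup>2) - s * ln (prod_list ys)"
      using sum_list_powr_neg_le[OF K s _ ys] slnK sL len by fastforce
    also have "\<dots> \<le> 6 * (1 + 2 * (s * ln K)\<^sup>2) - s * \<delta>"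
    proof -
      have "\<delta> \<le> ln (prod_list ys)" by (rule order_trans[OF \<delta>(3)]) (use prod in simp)
      then show ?thesis using s by simp
    qed
    also have "\<dots> \<le> 6 * \<rho>" using sq by (simp add: \<rho>_def algebra_simps)
    finally show "(\<Sum>y\<leftarrow>ys. y powr - s) \<le> 6 * \<rho>" .
  qed
qed

text \<open>The common part of two contractions: \<open>H\<close> will be \<open>sqnorm\<close> with
  \<open>\<mu>\<close> = 6 and \<open>proj_height\<close> with \<open>\<mu>\<close> = 1. Only the
  growth of \<open>H\<close> relative to \<open>\<mu>\<close> matters.\<close>

lemma height_drift:
  fixes H :: "int \<times> int \<times> int \<Rightarrow> real"
  assumes pos: "\<And>w. weights w \<Longrightarrow> 0 < H w" and "0 < \<mu>" "1 < K"
    and sym: "\<And>a b c. weights (a, b, c) \<Longrightarrow> H (b, a, c) = H (a, b, c) \<and> H (a, c, b) = H (a, b, c)"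
    and bounds: "\<And>w. weights w \<Longrightarrow> \<mu> * H w \<le> K * H (refine w) \<and> H (refine w) \<le> K * (\<mu> * H w)"
    and prod: "\<And>a b c. weights (a, b, c) \<Longrightarrow> 9/4 * (\<mu> * H (a, b, c)) ^ 6 \<le>
      H (refine (a, b, c)) * H (refine (a, c, b)) * H (refine (b, a, c)) *
      H (refine (b, c, a)) * H (refine (c, a, b)) * H (refine (c, b, a))"
  obtains s \<rho> :: real where "0 < s" "0 \<le> \<rho>" "\<rho> < 1"
    "\<And>w. weights w \<Longrightarrow>
       sym6 (\<lambda>v. H (refine v) powr - s) w \<le> 6 * (\<mu> powr - s * \<rho>) * H w powr - s"
proof (rule powr_neg_drift[OF \<open>1 < K\<close>])
  fix s \<rho> :: real
  assume s: "0 < s" "0 \<le> \<rho>" "\<rho> < 1" and drift: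
    "\<And>ys. \<lbrakk>\<And>y. y \<in> set ys \<Longrightarrow> 1 / K \<le> y \<and> y \<le> K; length ys = 6; 9/4 \<le> prod_list ys\<rbrakk>
       \<Longrightarrow> (\<Sum>y\<leftarrow>ys. y powr - s) \<le> 6 * \<rho>"
  show thesis
  proof (rule that[OF s])
    fix w assume w: "weights w"
    obtain a b c where w_eq: "w = (a, b, c)" by (cases w)
    define M where "M = \<mu> * H w"
    have M: "0 < M" using pos[OF w] \<open>0 < \<mu>\<close> by (simp add: M_def)
    have wts: "weights (a, b, c)" "weights (a, c, b)" "weights (b, a, c)"
      "weights (b, c, a)" "weights (c, a, b)" "weights (c, b, a)"
      using w by (auto simp: w_eq)
    \<comment> \<open>The two transpositions in \<open>sym\<close> generate all permutations, so the
      six ratios share one denominator \<open>M\<close>.\<close>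
    have H: "H (a, c, b) = H w" "H (b, a, c) = H w" "H (b, c, a) = H w" "H (c, a, b) = H w"
      "H (c, b, a) = H w"
      using sym[OF wts(1)] sym[OF wts(2)] sym[OF wts(3)] sym[OF wts(4)]
      unfolding w_eq by argo+
    define y where "y v = H (refine v) / M" for v
    have y: "1 / K \<le> y v \<and> y v \<le> K" if "weights v" "H v = H w" for v
      using bounds[OF that(1)] that(2) M \<open>1 < K\<close> by (simp add: y_def M_def[symmetric] field_simps)
    have yH: "H (refine v) powr - s = M powr - s * y v powr - s" if "weights v" for v
      using pos[OF weights_refine[OF that]] M
      by (subst powr_mult[symmetric]) (auto simp: y_def)
    let ?ys = "[y (a, b, c), y (a, c, b), y (b, a, c), y (b, c, a), y (c, a, b), y (c, b, a)]"
    have "9/4 \<le> prod_list ?ys"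
    proof -
      have "p / M * (q / M * (r / M * (t / M * (u / M * (v / M))))) = p * q * r * t * u * v / M ^ 6"
        for p q r t u v
        by (simp add: eval_nat_numeral)
      then have "prod_list ?ys = H (refine (a, b, c)) * H (refine (a, c, b)) * H (refine (b, a, c)) *
          H (refine (b, c, a)) * H (refine (c, a, b)) * H (refine (c, b, a)) / M ^ 6"
        by (simp only: y_def prod_list.Cons prod_list.Nil mult_1_right)
      also have "\<dots> \<ge> 9/4"
        using prod[OF wts(1), folded w_eq, folded M_def] M
        by (subst le_divide_eq) (simp add: w_eq del: refine.simps)
      finally show ?thesis .
    qed
    moreover have "\<forall>z\<in>set ?ys. 1 / K \<le> z \<and> z \<le> K"
      using y[OF wts(1)] y[OF wts(2) H(1)] y[OF wts(3) H(2)] y[OF wts(4) H(3)] y[OF wts(5) H(4)]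
        y[OF wts(6) H(5)]
      by (simp add: w_eq)
    ultimately have "(\<Sum>y\<leftarrow>?ys. y powr - s) \<le> 6 * \<rho>"
      by (intro drift) (blast, simp, assumption)
    then have "M powr - s * (\<Sum>y\<leftarrow>?ys. y powr - s) \<le> M powr - s * (6 * \<rho>)"
      by (intro mult_left_mono) auto
    moreover have "sym6 (\<lambda>v. H (refine v) powr - s) w = M powr - s * (\<Sum>y\<leftarrow>?ys. y powr - s)"
      unfolding w_eq sym6.simps yH[OF wts(1)] yH[OF wts(2)] yH[OF wts(3)] yH[OF wts(4)]
        yH[OF wts(5)] yH[OF wts(6)] by (simp add: distrib_left)
    moreover have "M powr - s = \<mu> powr - s * H w powr - s"
      using pos[OF w] \<open>0 < \<mu>\<close> by (simp add: M_def powr_mult)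
    ultimately show
      "sym6 (\<lambda>v. H (refine v) powr - s) w \<le> 6 * (\<mu> powr - s * \<rho>) * H w powr - s"
      by (simp add: mult_ac)
  qed
qed

lemma prod_sqnorm_refine_real:
  assumes "weights (a, b, c)"
  shows "9/4 * (6 * real_of_int (sqnorm (a, b, c))) ^ 6 \<le>
    real_of_int (sqnorm (refine (a, b, c)) * sqnorm (refine (a, c, b)) * sqnorm (refine (b, a, c)) *
      sqnorm (refine (b, c, a)) * sqnorm (refine (c, a, b)) * sqnorm (refine (c, b, a)))"
proof -
  have s: "a + b + c = 0" "a + c + b = 0" "b + a + c = 0" "b + c + a = 0" "c + a + b = 0" "c + b + a = 0"
    using assms by auto
  \<comment> \<open>Each of the six images carries a factor 6, and 46656 = 6^6.\<close>
  have pull: "6 * p * (6 * q) * (6 * r) * (6 * t) * (6 * u) * (6 * v) = 46656 * (p * q * r * t * u * v)"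
    for p q r t u v :: int
    by simp
  have "9 * (6 * sqnorm (a, b, c)) ^ 6 \<le> 4 * (sqnorm (refine (a, b, c)) * sqnorm (refine (a, c, b)) *
      sqnorm (refine (b, a, c)) * sqnorm (refine (b, c, a)) * sqnorm (refine (c, a, b)) *
      sqnorm (refine (c, b, a)))"
    using mult_left_mono[OF prod_sqnorm_refine[OF s(1)], of 46656]
    unfolding sqnorm_refine[OF s(1)] sqnorm_refine[OF s(2)] sqnorm_refine[OF s(3)]
      sqnorm_refine[OF s(4)] sqnorm_refine[OF s(5)] sqnorm_refine[OF s(6)] pull
    by (simp add: power_mult_distrib del: sqnorm.simps)
  then have "real_of_int (9 * (6 * sqnorm (a, b, c)) ^ 6) \<le> real_of_int (4 *
      (sqnorm (refine (a, b, c)) * sqnorm (refine (a, c, b)) *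
      sqnorm (refine (b, a, c)) * sqnorm (refine (b, c, a)) * sqnorm (refine (c, a, b)) *
      sqnorm (refine (c, b, a))))"
    by (simp only: of_int_le_iff)
  then show ?thesis by (simp del: sqnorm.simps refine.simps)
qed

lemma sqnorm_drift:
  obtains s \<rho> :: real where "0 < s" "0 \<le> \<rho>" "\<rho> < 1"
    "\<And>w. weights w \<Longrightarrow> sym6 (\<lambda>v. real_of_int (sqnorm (refine v)) powr - s) w
       \<le> 6 * (6 powr - s * \<rho>) * real_of_int (sqnorm w) powr - s"
\<comment> \<open>By \<open>sqnorm_refine_bounds\<close> the growth relative to 6 lies between 1/3
  and 3, well within the range allowed by K = 18.\<close>
proof (rule height_drift[where H = "\<lambda>w. real_of_int (sqnorm w)" and \<mu> = 6 and K = 18])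
  show "9/4 * (6 * real_of_int (sqnorm (a, b, c))) ^ 6 \<le>
      real_of_int (sqnorm (refine (a, b, c))) * real_of_int (sqnorm (refine (a, c, b))) *
      real_of_int (sqnorm (refine (b, a, c))) * real_of_int (sqnorm (refine (b, c, a))) *
      real_of_int (sqnorm (refine (c, a, b))) * real_of_int (sqnorm (refine (c, b, a)))"
    if "weights (a, b, c)" for a b c
    using prod_sqnorm_refine_real[OF that] by (simp only: of_int_mult)
  show "6 * real_of_int (sqnorm w) \<le> 18 * real_of_int (sqnorm (refine w)) \<and>
      real_of_int (sqnorm (refine w)) \<le> 18 * (6 * real_of_int (sqnorm w))" if "weights w" for w
    using sqnorm_refine_bounds[OF that] sqnorm_pos[OF that] by linarith
qed (use sqnorm_pos that in auto)

section \<open>Common divisors created by refinement\<close>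

text \<open>Eliminating between the coordinates 4 a + b and b - 2 a of the image yields 6 a and 6 b,
  so for a primitive vector the new content divides the determinant 6. Reducing the same coordinates
  modulo 2 and 3 tells when each prime can occur.\<close>

lemma content_refine_dvd:
  assumes "coprime a b" "a + b + c = 0"
  shows "content (refine (a, b, c)) dvd 6"
    "even (content (refine (a, b, c))) \<Longrightarrow> even b"
    "3 dvd content (refine (a, b, c)) \<Longrightarrow> 3 dvd c"
proof -
  have c: "c = - a - b" using assms by simp
  define e where "e = content (refine (a, b, c))"
  have e: "e dvd 4 * a + b" "e dvd b - 2 * a"
    unfolding e_def by (simp_all add: c algebra_simps)
  have "e dvd 6 * a" using dvd_diff[OF e] by simp
  moreover have "e dvd 6 * b"
  proof -
    have "e dvd 2 * ((4 * a + b) + 2 * (b - 2 * a))" by (rule dvd_mult[OF dvd_add[OF e(1) dvd_mult[OF e(2)]]])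
    then show ?thesis by (simp add: algebra_simps)
  qed
  ultimately have "e dvd gcd (6 * a) (6 * b)" by (rule gcd_greatest)
  moreover have "gcd (6 * a) (6 * b) = 6"
    using assms(1) gcd_mult_distrib_int[of 6 a b] by simp
  ultimately show "content (refine (a, b, c)) dvd 6"
    by (simp only: e_def)
  show "even (content (refine (a, b, c))) \<Longrightarrow> even b"
    using e(2) dvd_trans[of 2 e "b - 2 * a"] by (simp add: e_def)
  show "3 dvd content (refine (a, b, c)) \<Longrightarrow> 3 dvd c"
  proof -
    assume "3 dvd content (refine (a, b, c))"
    then have "3 dvd 4 * a + b" using e(1) dvd_trans by (metis e_def)
    then show "3 dvd c" unfolding c by presburger
  qed
qed

lemma content_refine_le:
  assumes "coprime a b" "a + b + c = 0"
  shows "content (refine (a, b, c)) \<le> (if even b then 2 else 1) * (if 3 dvd c then 3 else 1)"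
proof -
  define e where "e = content (refine (a, b, c))"
  note d = content_refine_dvd[OF assms, folded e_def]
  have "0 \<le> e" by (simp add: e_def)
  moreover have "e \<le> 6" using d(1) zdvd_imp_le by fastforce
  ultimately have "e \<in> {0,1,2,3,4,5,6}" by auto
  then have "e \<in> {1,2,3,6}" using d(1) by auto
  then have "e \<le> (if even b then 2 else 1) * (if 3 dvd c then 3 else 1)"
    using d(2,3) by auto
  then show ?thesis by (simp add: e_def)
qed

section \<open>Projective heights\<close>

text \<open>The squared Euclidean height of the rational line through \<open>w\<close>, that is,
  \<open>sqnorm\<close> of a primitive vector on it.\<close>

definition proj_height :: "int \<times> int \<times> int \<Rightarrow> real" where
  "proj_height w = real_of_int (sqnorm w) / (real_of_int (content w))\<^sup>2"

lemma weights_primitive: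
  assumes "weights w"
  obtains d a b c where "0 < d" "coprime a b" "a + b + c = 0" "weights (a, b, c)"
    "w = (d * a, d * b, d * c)"
proof -
  obtain x y z where w: "w = (x, y, z)" by (cases w)
  define d where "d = gcd x y"
  have xy: "x + y + z = 0" "x \<noteq> 0 \<or> y \<noteq> 0" using assms w by auto
  have d: "0 < d" using xy by (simp add: d_def)
  have "gcd x y \<noteq> 0" using d by (simp add: d_def)
  from gcd_coprime_exists[OF this] obtain a b where "x = a * d" "y = b * d" "coprime a b"
    unfolding d_def by blast
  then have ab: "x = d * a" "y = d * b" "coprime a b" by (simp_all only: mult.commute)
  have "z = d * (- a - b)" using xy(1) ab by (simp add: algebra_simps)
  then show thesis
    using that[of d a b "- a - b"] d ab xy w by auto
qed

lemma content_sym: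
  assumes "a + b + c = 0"
  shows "content (b, a, c) = content (a, b, c)" "content (a, c, b) = content (a, b, c)"
proof -
  have c: "c = - (a + b)" using assms by simp
  show "content (b, a, c) = content (a, b, c)" by (simp add: gcd.commute)
  show "content (a, c, b) = content (a, b, c)" by (simp only: c content.simps gcd_neg2 gcd_add2)
qed

lemma proj_height_scale:
  assumes "0 < d"
  shows "proj_height (d * a, d * b, d * c) = proj_height (a, b, c)"
proof -
  have "content (d * a, d * b, d * c) = d * content (a, b, c)"
    using gcd_mult_distrib_int[of d a b] assms by simp
  moreover have "sqnorm (d * a, d * b, d * c) = d\<^sup>2 * sqnorm (a, b, c)"
    by (simp add: power_mult_distrib distrib_left)
  ultimately show ?thesis
    using assms by (simp add: proj_height_def power_mult_distrib del: content.simps sqnorm.simps)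
qed

lemma refine_scale: "refine (d * a, d * b, d * c) = (case refine (a, b, c) of (x, y, z) \<Rightarrow> (d * x, d * y, d * z))"
  by (simp add: algebra_simps)

lemma proj_height_refine_scale:
  assumes "0 < d"
  shows "proj_height (refine (d * a, d * b, d * c)) = proj_height (refine (a, b, c))"
  unfolding refine_scale using proj_height_scale[OF assms] by (simp split: prod.split)

lemma content_pos: "weights w \<Longrightarrow> 0 < content w"
  by (cases w) auto

lemma proj_height_pos: "weights w \<Longrightarrow> 0 < proj_height w"
  using sqnorm_pos[of w] content_pos[of w] by (simp add: proj_height_def)

text \<open>On a primitive vector the new content lies between 1 and 6. Division by its square, at
  most 36, turns the lower factor 2 of \<open>sqnorm_refine_bounds\<close> into 1/18, and the upper
  factor 18 persists.\<close>

lemma proj_height_refine_bounds: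
  assumes "weights w"
  shows "proj_height w \<le> 18 * proj_height (refine w)" "proj_height (refine w) \<le> 18 * proj_height w"
proof -
  obtain d a b c where d: "0 < d" and cop: "coprime a b" "a + b + c = 0" and w: "weights (a, b, c)"
    and eq: "w = (d * a, d * b, d * c)"
    by (rule weights_primitive[OF assms])
  define N where "N = real_of_int (sqnorm (a, b, c))"
  define M where "M = real_of_int (sqnorm (refine (a, b, c)))"
  define e where "e = real_of_int (content (refine (a, b, c)))"
  have "1 \<le> content (refine (a, b, c))"
    using content_pos[OF weights_refine[OF w]] by linarith
  moreover have "content (refine (a, b, c)) \<le> 6"
    using content_refine_dvd(1)[OF cop] zdvd_imp_le by fastforce
  ultimately have e: "1 \<le> e" "e \<le> 6" unfolding e_def by linarith+
  have e2: "1 \<le> e\<^sup>2" "e\<^sup>2 \<le> 36" "0 < e\<^sup>2" using e power_mono[of e 6 2] by auto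
  have N: "0 < N" using sqnorm_pos[OF w] unfolding N_def by (simp only: of_int_0_less_iff)
  have M: "2 * N \<le> M" "M \<le> 18 * N"
    using sqnorm_refine_bounds[OF w] unfolding M_def N_def by linarith+
  have H: "proj_height w = N" "proj_height (refine w) = M / e\<^sup>2"
    unfolding eq proj_height_scale[OF d] proj_height_refine_scale[OF d]
    using cop(1) by (simp_all add: proj_height_def N_def M_def e_def del: sqnorm.simps refine.simps)
  have "N * e\<^sup>2 \<le> N * 36" using N e2 by (intro mult_left_mono) auto
  then show "proj_height w \<le> 18 * proj_height (refine w)"
    using M e2 unfolding H by (simp add: field_simps)
  have "18 * N * 1 \<le> 18 * N * e\<^sup>2" using N e2 by (intro mult_left_mono) auto
  then show "proj_height (refine w) \<le> 18 * proj_height w"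
    using M e2 unfolding H by (simp add: field_simps)
qed

text \<open>A primitive sum-zero vector has exactly one even coordinate and at most one divisible by
  3. Each coordinate is in the middle for two permutations and last for two, so the primes
  contribute at most 2^2 and 3^2.\<close>

lemma prod_content_refine_le:
  assumes cop: "coprime a b" and s: "a + b + c = 0"
  shows "content (refine (a, b, c)) * content (refine (a, c, b)) * content (refine (b, a, c)) *
      content (refine (b, c, a)) * content (refine (c, a, b)) * content (refine (c, b, a)) \<le> 36"
proof -
  define E :: "int \<Rightarrow> int" where "E x = (if even x then 2 else 1)" for x
  define F :: "int \<Rightarrow> int" where "F x = (if 3 dvd x then 3 else 1)" for x
  have c: "c = - (a + b)" using s by simp
  have cop': "coprime a c" "coprime b c" "coprime b a" "coprime c a" "coprime c b"
  proof -
    have "gcd a c = gcd a b" using content_sym(2)[OF s] by simp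
    moreover have "gcd b c = gcd b a"
      using content_sym(2)[of b a c] s by (simp only: content.simps add.commute)
    ultimately show "coprime a c" "coprime b c" "coprime b a" "coprime c a" "coprime c b"
      using cop by (simp_all add: coprime_iff_gcd_eq_1 gcd.commute)
  qed
  have le: "content (refine (x, y, z)) \<le> E y * F z" "0 \<le> content (refine (x, y, z))"
    if "coprime x y" "x + y + z = 0" for x y z
    using content_refine_le[OF that] by (auto simp: E_def F_def)
  have mono: "p1 * p2 * p3 * p4 * p5 * p6 \<le> q1 * q2 * q3 * q4 * q5 * q6"
    if "0 \<le> p1" "0 \<le> p2" "0 \<le> p3" "0 \<le> p4" "0 \<le> p5" "0 \<le> p6"
      "p1 \<le> q1" "p2 \<le> q2" "p3 \<le> q3" "p4 \<le> q4" "p5 \<le> q5" "p6 \<le> q6"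
    for p1 p2 p3 p4 p5 p6 q1 q2 q3 q4 q5 q6 :: int
    using that by (intro mult_mono mult_nonneg_nonneg) auto
  have "content (refine (a, b, c)) * content (refine (a, c, b)) * content (refine (b, a, c)) *
      content (refine (b, c, a)) * content (refine (c, a, b)) * content (refine (c, b, a))
    \<le> (E b * F c) * (E c * F b) * (E a * F c) * (E c * F a) * (E a * F b) * (E b * F a)"
    by (intro mono le cop cop') (use s in simp_all)
  also have "\<dots> = (E a * E b * E c)\<^sup>2 * (F a * F b * F c)\<^sup>2"
    by (simp add: power2_eq_square)
  also have "\<dots> \<le> 2\<^sup>2 * 3\<^sup>2"
  proof (intro mult_mono power_mono)
    have "\<not> (even a \<and> even b)"
      using cop coprime_common_divisor[of a b 2] by auto
    moreover have "even c \<longleftrightarrow> (even a \<longleftrightarrow> even b)" by (auto simp: c)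
    ultimately show "E a * E b * E c \<le> 2" unfolding E_def by auto
    have "\<not> (3 dvd a \<and> 3 dvd b)"
      using cop coprime_common_divisor[of a b 3] by auto
    then have "\<not> (3 dvd a \<and> 3 dvd b)" "\<not> (3 dvd a \<and> 3 dvd c)" "\<not> (3 dvd b \<and> 3 dvd c)"
      unfolding c by presburger+
    then show "F a * F b * F c \<le> 3" unfolding F_def by auto
  qed (auto simp: E_def F_def)
  finally show ?thesis by simp
qed

lemma prod_proj_height_refine:
  assumes "weights (a, b, c)"
  shows "9/4 * proj_height (a, b, c) ^ 6 \<le>
    proj_height (refine (a, b, c)) * proj_height (refine (a, c, b)) * proj_height (refine (b, a, c)) *
    proj_height (refine (b, c, a)) * proj_height (refine (c, a, b)) * proj_height (refine (c, b, a))"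
proof -
  have primitive: "9/4 * proj_height (a, b, c) ^ 6 \<le>
      proj_height (refine (a, b, c)) * proj_height (refine (a, c, b)) * proj_height (refine (b, a, c)) *
      proj_height (refine (b, c, a)) * proj_height (refine (c, a, b)) * proj_height (refine (c, b, a))"
    if cop: "coprime a b" and w: "weights (a, b, c)" for a b c
  proof -
    have s: "a + b + c = 0" using w by simp
    have wts: "weights (a, b, c)" "weights (a, c, b)" "weights (b, a, c)"
      "weights (b, c, a)" "weights (c, a, b)" "weights (c, b, a)"
      using w by auto
    note pos = wts[THEN weights_refine, THEN content_pos]
    define e where "e = content (refine (a, b, c)) * content (refine (a, c, b)) *
      content (refine (b, a, c)) * content (refine (b, c, a)) * content (refine (c, a, b)) *
      content (refine (c, b, a))"
    define M where "M = sqnorm (refine (a, b, c)) * sqnorm (refine (a, c, b)) *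
      sqnorm (refine (b, a, c)) * sqnorm (refine (b, c, a)) * sqnorm (refine (c, a, b)) *
      sqnorm (refine (c, b, a))"
    have "0 < e" unfolding e_def by (intro mult_pos_pos pos)
    have e: "0 < real_of_int e" "real_of_int e \<le> 36"
      using \<open>0 < e\<close> prod_content_refine_le[OF cop s] unfolding e_def[symmetric] by linarith+
    have e2: "(real_of_int e)\<^sup>2 \<le> 36\<^sup>2" using e by (intro power_mono) auto
    have N: "proj_height (a, b, c) = real_of_int (sqnorm (a, b, c))"
      using cop by (simp add: proj_height_def)
    have "9/4 * proj_height (a, b, c) ^ 6 * (real_of_int e)\<^sup>2 \<le> 9/4 * proj_height (a, b, c) ^ 6 * 36\<^sup>2"
      using e2 proj_height_pos[OF w] by (intro mult_left_mono) auto
    \<comment> \<open>The squared contents cost at most 36^2 = 6^4, less than the 6^6 supplied by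
      the determinant.\<close>
    also have "\<dots> \<le> 9/4 * (6 * proj_height (a, b, c)) ^ 6"
      using proj_height_pos[OF w] by (simp add: power_mult_distrib)
    also have "\<dots> \<le> real_of_int M"
      using prod_sqnorm_refine_real[OF w] unfolding M_def N .
    finally have "9/4 * proj_height (a, b, c) ^ 6 \<le> real_of_int M / (real_of_int e)\<^sup>2"
      using e by (simp add: le_divide_eq)
    also have "real_of_int M / (real_of_int e)\<^sup>2 =
      proj_height (refine (a, b, c)) * proj_height (refine (a, c, b)) * proj_height (refine (b, a, c)) *
      proj_height (refine (b, c, a)) * proj_height (refine (c, a, b)) * proj_height (refine (c, b, a))"
      unfolding M_def e_def proj_height_def of_int_mult power_mult_distrib by (simp only: times_divide_times_eq)
    finally show ?thesis .
  qed
  obtain d x y z where d: "0 < d" and cop: "coprime x y" and w: "weights (x, y, z)"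
    and "(a, b, c) = (d * x, d * y, d * z)"
    by (rule weights_primitive[OF assms])
  then have eq: "a = d * x" "b = d * y" "c = d * z" by simp_all
  show ?thesis
    using primitive[OF cop w] unfolding eq proj_height_scale[OF d] proj_height_refine_scale[OF d] .
qed

lemma proj_height_sym:
  assumes "weights (a, b, c)"
  shows "proj_height (b, a, c) = proj_height (a, b, c) \<and> proj_height (a, c, b) = proj_height (a, b, c)"
  using content_sym[of a b c] assms by (simp add: proj_height_def)

lemma proj_height_powr_drift:
  obtains s \<rho> :: real where "0 < s" "0 \<le> \<rho>" "\<rho> < 1"
    "\<And>w. weights w \<Longrightarrow> sym6 (\<lambda>v. proj_height (refine v) powr - s) w \<le> 6 * \<rho> * proj_height w powr - s"
proof (rule height_drift[where H = proj_height and \<mu> = 1 and K = 18])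
  show "proj_height (b, a, c) = proj_height (a, b, c) \<and> proj_height (a, c, b) = proj_height (a, b, c)"
    if "weights (a, b, c)" for a b c
    by (rule proj_height_sym[OF that])
  show "1 * proj_height w \<le> 18 * proj_height (refine w) \<and> proj_height (refine w) \<le> 18 * (1 * proj_height w)"
    if "weights w" for w
    using proj_height_refine_bounds[OF that] by simp
  show "9/4 * (1 * proj_height (a, b, c)) ^ 6 \<le>
    proj_height (refine (a, b, c)) * proj_height (refine (a, c, b)) * proj_height (refine (b, a, c)) *
    proj_height (refine (b, c, a)) * proj_height (refine (c, a, b)) * proj_height (refine (c, b, a))"
    if "weights (a, b, c)" for a b c
    using prod_proj_height_refine[OF that] by simp
qed (use proj_height_pos that in auto)

section \<open>Vanishing and size of combinations in terms of their coefficients\<close>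

text \<open>Since A - C and B - C are not both zero, two integer relations between the vertices have
  vanishing determinant a y - b x. Hence they span the same line, on which the height is
  constant.\<close>

lemma proj_height_eq_if_comb_zero:
  assumes T: "nondeg_triangle T" and v: "weights v" "comb v T = 0" and w: "weights w" "comb w T = 0"
  shows "proj_height v = proj_height w"
proof -
  obtain A B C where T_eq: "T = (A, B, C)" by (cases T)
  obtain a b c x y z where vw: "v = (a, b, c)" "w = (x, y, z)" by (cases v; cases w)
  have c: "c = - a - b" and z: "z = - x - y" using v w by (auto simp: vw)
  have 1: "of_int a * (A - C) + of_int b * (B - C) = 0" "of_int x * (A - C) + of_int y * (B - C) = 0"
    using v w by (auto simp: T_eq vw c z algebra_simps)
  have "of_int (a * y - b * x) * (A - C) = 0" "of_int (a * y - b * x) * (B - C) = 0"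
    using 1 by (simp_all, algebra+)
  moreover have "A - C \<noteq> 0 \<or> B - C \<noteq> 0" using T by (auto simp: T_eq nondeg_triangle_def)
  ultimately have ay: "a * y = b * x" by (auto simp del: of_int_mult of_int_diff)
  define d where "d = gcd a b"
  define e where "e = gcd x y"
  have "d * \<bar>x\<bar> = gcd (x * a) (x * b)"
    using gcd_mult_distrib_int[of x a b] by (simp add: d_def mult.commute)
  also have "\<dots> = gcd (a * x) (a * y)" by (simp add: ay mult.commute)
  also have "\<dots> = \<bar>a\<bar> * e" unfolding e_def by (rule gcd_mult_distrib_int[symmetric])
  finally have dx: "d * \<bar>x\<bar> = \<bar>a\<bar> * e" .
  have "d * \<bar>y\<bar> = gcd (y * a) (y * b)"
    using gcd_mult_distrib_int[of y a b] by (simp add: d_def mult.commute)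
  also have "\<dots> = gcd (b * x) (b * y)" by (simp add: ay mult.commute)
  also have "\<dots> = \<bar>b\<bar> * e" unfolding e_def by (rule gcd_mult_distrib_int[symmetric])
  finally have dy: "d * \<bar>y\<bar> = \<bar>b\<bar> * e" .
  have x2: "d\<^sup>2 * x\<^sup>2 = a\<^sup>2 * e\<^sup>2"
    using arg_cong[OF dx, of "\<lambda>t. t\<^sup>2"] by (simp add: power_mult_distrib)
  have y2: "d\<^sup>2 * y\<^sup>2 = b\<^sup>2 * e\<^sup>2"
    using arg_cong[OF dy, of "\<lambda>t. t\<^sup>2"] by (simp add: power_mult_distrib)
  \<comment> \<open>The absolute values in \<open>dx\<close> and \<open>dy\<close> lose the signs,
    which the mixed term of \<open>sqnorm\<close> needs; they are recovered from
    \<open>ay\<close>.\<close>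
  have xy: "d\<^sup>2 * (x * y) = a * b * e\<^sup>2"
  proof (cases "x = 0")
    case True
    then have "a * y = 0" using ay by simp
    moreover have "y \<noteq> 0" using True w by (auto simp: vw)
    ultimately show ?thesis using True by simp
  next
    case False
    have "x * (d\<^sup>2 * (x * y)) = (d\<^sup>2 * x\<^sup>2) * y" by (simp add: power2_eq_square)
    also have "\<dots> = x * (a * b * e\<^sup>2)" unfolding x2 using ay by (simp add: power2_eq_square)
    finally show ?thesis using False by simp
  qed
  have "sqnorm v * e\<^sup>2 = 2 * (a\<^sup>2 * e\<^sup>2 + a * b * e\<^sup>2 + b\<^sup>2 * e\<^sup>2)"
    by (simp add: vw c power2_eq_square algebra_simps)
  also have "\<dots> = sqnorm w * d\<^sup>2"
    unfolding x2[symmetric] y2[symmetric] xy[symmetric] by (simp add: vw z power2_eq_square algebra_simps)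
  finally have "real_of_int (sqnorm v * (content w)\<^sup>2) = real_of_int (sqnorm w * (content v)\<^sup>2)"
    by (simp add: vw d_def e_def)
  then show ?thesis
    using content_pos[OF v(1)] content_pos[OF w(1)]
    by (simp add: proj_height_def field_simps del: sqnorm.simps content.simps)
qed

text \<open>When the area is positive, \<open>u\<close> and \<open>v\<close> form a real basis of
  the plane, so the coefficients of a combination are controlled by its length.\<close>

lemma sqnorm_le_comb:
  assumes T: "Im (cnj (B - A) * (C - A)) \<noteq> 0"
  obtains k :: real where "0 < k"
    "\<And>w. weights w \<Longrightarrow> k * real_of_int (sqnorm w) \<le> (cmod (comb w (A, B, C)))\<^sup>2"
proof -
  define u where "u = B - A"
  define v where "v = C - A"
  define X where "X = Im (cnj u * v)"
  define k where "k = X\<^sup>2 / (3 * ((cmod u)\<^sup>2 + (cmod v)\<^sup>2))"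
  have X: "X \<noteq> 0" using T by (simp add: X_def u_def v_def)
  then have "u \<noteq> 0" by (auto simp: X_def)
  then have pos: "0 < (cmod u)\<^sup>2 + (cmod v)\<^sup>2" by (simp add: add_pos_nonneg)
  show thesis
  proof (rule that[of k])
    show "0 < k" using X pos by (simp add: k_def)
    fix w assume w: "weights w"
    obtain a b c where w_eq: "w = (a, b, c)" by (cases w)
    have a: "a = - b - c" using w by (simp add: w_eq)
    define z where "z = comb w (A, B, C)"
    have z: "z = of_int b * u + of_int c * v"
      by (simp add: z_def w_eq a u_def v_def algebra_simps)
    \<comment> \<open>Cramer's rule, with \<open>X\<close> the determinant of \<open>u\<close> and
      \<open>v\<close>.\<close>
    have "Im (cnj z * v) = b * X" "Im (cnj u * z) = c * X"
      by (simp_all add: z X_def algebra_simps)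
    then have "\<bar>b * X\<bar> \<le> cmod z * cmod v" "\<bar>c * X\<bar> \<le> cmod u * cmod z"
      by (metis abs_Im_le_cmod complex_mod_cnj norm_mult)+
    then have "\<bar>b * X\<bar>\<^sup>2 \<le> (cmod z * cmod v)\<^sup>2" "\<bar>c * X\<bar>\<^sup>2 \<le> (cmod u * cmod z)\<^sup>2"
      by (intro power_mono; simp)+
    then have le: "X\<^sup>2 * (b\<^sup>2 + c\<^sup>2) \<le> (cmod z)\<^sup>2 * ((cmod u)\<^sup>2 + (cmod v)\<^sup>2)"
      by (simp add: power_mult_distrib algebra_simps)
    have "0 \<le> (real_of_int b - c)\<^sup>2" by simp
    then have "sqnorm w \<le> 3 * (real_of_int b ^ 2 + c\<^sup>2)"
      by (simp add: w_eq a power2_eq_square algebra_simps)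
    then have "X\<^sup>2 * sqnorm w \<le> X\<^sup>2 * (3 * (real_of_int b ^ 2 + c\<^sup>2))"
      by (intro mult_left_mono) auto
    also have "\<dots> \<le> (cmod z)\<^sup>2 * (3 * ((cmod u)\<^sup>2 + (cmod v)\<^sup>2))"
      using le by (simp add: algebra_simps)
    finally show "k * real_of_int (sqnorm w) \<le> (cmod (comb w (A, B, C)))\<^sup>2"
      using pos by (simp add: k_def z_def field_simps del: sqnorm.simps comb.simps)
  qed
qed

section \<open>Characterizing points and largest angles\<close>

text \<open>The ratio \<open>k\<close> is the modulus of the linear coefficient. Reflections reverse
  the orientation, so the area is tracked up to sign.\<close>

lemma similitude_scale:
  assumes "similitude f"
  obtains k :: real where "0 < k"
    "\<And>x y. dist (f x) (f y) = k * dist x y"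
    "\<And>x y z. \<bar>Im (cnj (f y - f x) * (f z - f x))\<bar> = k\<^sup>2 * \<bar>Im (cnj (y - x) * (z - x))\<bar>"
proof -
  obtain a b where a: "a \<noteq> 0" and f: "(\<forall>z. f z = a * z + b) \<or> (\<forall>z. f z = a * cnj z + b)"
    using assms by (auto simp: similitude_def)
  have diff: "(\<forall>x y. f x - f y = a * (x - y)) \<or> (\<forall>x y. f x - f y = a * cnj (x - y))"
    using f by (auto simp: algebra_simps)
  have aa: "cnj a * a = of_real ((cmod a)\<^sup>2)"
    by (metis complex_norm_square mult.commute)
  have area: "cnj (a * u) * (a * v) = of_real ((cmod a)\<^sup>2) * (cnj u * v)" for u v
    unfolding aa[symmetric] by (simp add: mult_ac)
  have Im_of_real_mult: "Im (of_real r * u) = r * Im u" for r u by simp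
  show thesis
  proof (rule that[of "cmod a"])
    show "0 < cmod a" using a by simp
    show "dist (f x) (f y) = cmod a * dist x y" for x y
      using diff complex_mod_cnj[of "x - y"] unfolding dist_norm by (metis norm_mult)
    fix x y z
    from diff show "\<bar>Im (cnj (f y - f x) * (f z - f x))\<bar> = (cmod a)\<^sup>2 * \<bar>Im (cnj (y - x) * (z - x))\<bar>"
    proof
      assume d: "\<forall>x y. f x - f y = a * (x - y)"
      show ?thesis
        unfolding d[rule_format] area by (simp only: Im_of_real_mult abs_mult) simp
    next
      assume d: "\<forall>x y. f x - f y = a * cnj (x - y)"
      have "Im (cnj (cnj (y - x)) * cnj (z - x)) = - Im (cnj (y - x) * (z - x))"
        by (simp add: algebra_simps)
      then show ?thesis
        unfolding d[rule_format] area by (simp only: Im_of_real_mult abs_mult abs_minus) simp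
    qed
  qed
qed

definition orderings :: "triangle \<Rightarrow> triangle set" where
  "orderings T = (case T of (A, B, C) \<Rightarrow> {(A, B, C), (A, C, B), (B, A, C), (B, C, A), (C, A, B), (C, B, A)})"

lemma is_char_point_iff:
  "is_char_point T p \<longleftrightarrow> 0 \<le> Re p \<and> Re p \<le> 1/2 \<and> 0 \<le> Im p \<and>
     (\<exists>P Q R f. (P, Q, R) \<in> orderings T \<and> dist P Q \<ge> dist Q R \<and> dist Q R \<ge> dist P R \<and>
        similitude f \<and> f P = 0 \<and> f Q = 1 \<and> f R = p)"
  by (cases T) (simp add: is_char_point_def orderings_def)

lemma exists_sorted_ordering:
  "\<exists>P Q R. (P, Q, R) \<in> orderings T \<and> dist P Q \<ge> dist Q R \<and> dist Q R \<ge> dist P R"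
proof -
  obtain A B C where T: "T = (A, B, C)" by (cases T)
  note c = dist_commute[of B A] dist_commute[of C A] dist_commute[of C B]
  have "(dist A B \<ge> dist B C \<and> dist B C \<ge> dist A C) \<or> (dist A C \<ge> dist C B \<and> dist C B \<ge> dist A B)
    \<or> (dist B A \<ge> dist A C \<and> dist A C \<ge> dist B C) \<or> (dist B C \<ge> dist C A \<and> dist C A \<ge> dist B A)
    \<or> (dist C A \<ge> dist A B \<and> dist A B \<ge> dist C B) \<or> (dist C B \<ge> dist B A \<and> dist B A \<ge> dist C A)"
    unfolding c by linarith
  then show ?thesis unfolding T orderings_def by blast
qed

text \<open>Ties allow several sorted orderings, but the lengths are always the maximum, the
  remainder and the minimum. This makes the characterizing point independent of the
  ordering.\<close>

lemma sorted_ordering_unique: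
  assumes "(P, Q, R) \<in> orderings T" "dist P Q \<ge> dist Q R" "dist Q R \<ge> dist P R"
    and "(P', Q', R') \<in> orderings T" "dist P' Q' \<ge> dist Q' R'" "dist Q' R' \<ge> dist P' R'"
  shows "dist P Q = dist P' Q'" "dist Q R = dist Q' R'" "dist P R = dist P' R'"
proof -
  obtain A B C where T: "T = (A, B, C)" by (cases T)
  define x where "x = dist A B"
  define y where "y = dist B C"
  define z where "z = dist A C"
  have char: "dist P Q = max x (max y z) \<and> dist P R = min x (min y z) \<and>
      dist P Q + dist Q R + dist P R = x + y + z"
    if "(P, Q, R) \<in> orderings T" "dist P Q \<ge> dist Q R" "dist Q R \<ge> dist P R" for P Q R
    using that unfolding T orderings_def x_def y_def z_def
    by (auto simp: dist_commute[of B A] dist_commute[of C A] dist_commute[of C B])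
  show "dist P Q = dist P' Q'" "dist Q R = dist Q' R'" "dist P R = dist P' R'"
    using char[OF assms(1-3)] char[OF assms(4-6)] by linarith+
qed

lemma ordering_distinct:
  assumes "nondeg_triangle T" "(P, Q, R) \<in> orderings T" "dist P Q \<ge> dist Q R" "dist Q R \<ge> dist P R"
  shows "P \<noteq> Q"
proof
  assume "P = Q"
  then have "Q = R" using assms(3) by simp
  with \<open>P = Q\<close> show False using assms(1,2) by (cases T) (auto simp: orderings_def nondeg_triangle_def)
qed

text \<open>Send a longest edge to [0, 1] and reflect if the third vertex falls below the real axis.
  The chain |p| \<le> |p - 1| \<le> 1 then gives both bounds on the real part.\<close>

lemma ex_is_char_point:
  assumes "nondeg_triangle T"
  shows "\<exists>p. is_char_point T p"
proof -
  obtain P Q R where o: "(P, Q, R) \<in> orderings T" "dist P Q \<ge> dist Q R" "dist Q R \<ge> dist P R"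
    using exists_sorted_ordering by blast
  have PQ: "P \<noteq> Q" by (rule ordering_distinct[OF assms o])
  define g where "g z = (z - P) / (Q - P)" for z
  define f where "f = (if 0 \<le> Im (g R) then g else (\<lambda>z. cnj (g z)))"
  have f: "f P = 0" "f Q = 1" using PQ by (auto simp: f_def g_def)
  have Im_f: "0 \<le> Im (f R)" by (auto simp: f_def)
  have "similitude g" unfolding similitude_def g_def
    by (rule exI[of _ "1 / (Q - P)"], rule exI[of _ "- P / (Q - P)"])
       (use PQ in \<open>auto simp: diff_divide_distrib\<close>)
  moreover have "similitude (\<lambda>z. cnj (g z))" unfolding similitude_def g_def
    by (rule exI[of _ "cnj (1 / (Q - P))"], rule exI[of _ "cnj (- P / (Q - P))"])
       (use PQ in \<open>auto simp: diff_divide_distrib\<close>)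
  ultimately have sim: "similitude f" by (simp add: f_def)
  then obtain k where k: "0 < k" "\<And>x y. dist (f x) (f y) = k * dist x y"
    by (rule similitude_scale) blast
  define p where "p = f R"
  have 1: "1 = k * dist P Q" "cmod p = k * dist P R" "cmod (p - 1) = k * dist Q R"
    using k(2)[of P Q] k(2)[of R P] k(2)[of R Q] f
    by (simp_all add: p_def dist_norm norm_minus_commute)
  have "cmod p \<le> cmod (p - 1)" "cmod (p - 1) \<le> 1"
    using o k(1) unfolding 1(2,3) by (simp, subst 1(1), simp)
  then have "(cmod p)\<^sup>2 \<le> (cmod (p - 1))\<^sup>2" "(cmod (p - 1))\<^sup>2 \<le> 1"
    by (auto intro: power_mono simp: power_le_one)
  then have "(Re p)\<^sup>2 + (Im p)\<^sup>2 \<le> (Re p - 1)\<^sup>2 + (Im p)\<^sup>2" "(Re p - 1)\<^sup>2 + (Im p)\<^sup>2 \<le> 1"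
    by (simp_all add: cmod_power2)
  then have "Re p \<le> 1/2" "(Re p)\<^sup>2 + (Im p)\<^sup>2 \<le> 2 * Re p"
    by (simp_all add: power2_eq_square algebra_simps)
  moreover from this(2) have "0 \<le> Re p" by (smt (verit) zero_le_power2)
  ultimately have "is_char_point T p"
    unfolding is_char_point_iff using o f Im_f sim p_def by blast
  then show ?thesis ..
qed

text \<open>The distances of the point from 0 and 1 are ratios of sorted edge lengths, hence
  determined by \<open>T\<close>; the sign of the imaginary part selects one of the two
  intersections of the circles.\<close>

lemma is_char_point_unique:
  assumes "is_char_point T p" "is_char_point T q"
  shows "p = q"
proof -
  have char: "\<exists>P Q R. (P, Q, R) \<in> orderings T \<and> dist P Q \<ge> dist Q R \<and> dist Q R \<ge> dist P R \<and>
      cmod p = dist P R / dist P Q \<and> cmod (p - 1) = dist Q R / dist P Q \<and> 0 \<le> Im p"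
    if "is_char_point T p" for p
  proof -
    obtain P Q R f where o: "(P, Q, R) \<in> orderings T" "dist P Q \<ge> dist Q R" "dist Q R \<ge> dist P R"
      and f: "similitude f" "f P = 0" "f Q = 1" "f R = p" and p: "0 \<le> Im p"
      using \<open>is_char_point T p\<close> unfolding is_char_point_iff by blast
    obtain k where k: "0 < k" "\<And>x y. dist (f x) (f y) = k * dist x y"
      using f(1) by (rule similitude_scale) blast
    have 1: "1 = k * dist P Q" "cmod p = k * dist P R" "cmod (p - 1) = k * dist Q R"
      using k(2)[of P Q] k(2)[of R P] k(2)[of R Q] f
      by (simp_all add: dist_norm norm_minus_commute)
    then have "k = 1 / dist P Q" by (metis mult_zero_right nonzero_eq_divide_eq zero_neq_one)
    then show ?thesis using 1 o p by auto
  qed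
  obtain P Q R where P: "(P, Q, R) \<in> orderings T" "dist P Q \<ge> dist Q R" "dist Q R \<ge> dist P R"
      "cmod p = dist P R / dist P Q" "cmod (p - 1) = dist Q R / dist P Q" "0 \<le> Im p"
    using char[OF assms(1)] by blast
  obtain P' Q' R' where Q: "(P', Q', R') \<in> orderings T" "dist P' Q' \<ge> dist Q' R'" "dist Q' R' \<ge> dist P' R'"
      "cmod q = dist P' R' / dist P' Q'" "cmod (q - 1) = dist Q' R' / dist P' Q'" "0 \<le> Im q"
    using char[OF assms(2)] by blast
  note eqs = sorted_ordering_unique[OF P(1-3) Q(1-3)]
  have eq: "cmod p = cmod q" "cmod (p - 1) = cmod (q - 1)" and im: "0 \<le> Im p" "0 \<le> Im q"
    using P(4-6) Q(4-6) unfolding eqs by simp_all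
  have "(cmod p)\<^sup>2 = (cmod q)\<^sup>2" "(cmod (p - 1))\<^sup>2 = (cmod (q - 1))\<^sup>2" using eq by simp_all
  then have "(Re p)\<^sup>2 + (Im p)\<^sup>2 = (Re q)\<^sup>2 + (Im q)\<^sup>2"
    "(Re p - 1)\<^sup>2 + (Im p)\<^sup>2 = (Re q - 1)\<^sup>2 + (Im q)\<^sup>2"
    by (simp_all add: cmod_power2)
  then have "Re p = Re q" "(Im p)\<^sup>2 = (Im q)\<^sup>2"
    by (simp_all add: power2_eq_square algebra_simps)
  then show "p = q" using im by (simp add: complex_eq_iff)
qed

lemma is_char_point_char_point:
  assumes "nondeg_triangle T"
  shows "is_char_point T (char_point T)"
  unfolding char_point_def
  using ex_is_char_point[OF assms] is_char_point_unique by (metis theI')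

text \<open>Write A for the angle and n for the product of the sides at p, so Im p = n sin A. As A
  faces a longest edge, cos A \<le> 1/2, and the hypothesis bounds cos A from below away from -1. So
  sin A stays away from 0, and n \<ge> |p|^2.\<close>

lemma vertex_angle_flat:
  fixes \<epsilon> :: real
  assumes "0 < \<epsilon>"
  obtains \<delta> :: real where "0 < \<delta>"
    "\<And>p. \<lbrakk>cmod p \<le> cmod (p - 1); cmod (p - 1) \<le> 1; 0 \<le> Im p; vertex_angle p 0 1 < pi - \<epsilon>\<rbrakk>
       \<Longrightarrow> \<delta> * (cmod p)\<^sup>2 \<le> Im p"
proof -
  define \<eta> where "\<eta> = min \<epsilon> (pi / 2)"
  have \<eta>: "0 < \<eta>" "\<eta> \<le> pi / 2" "\<eta> \<le> \<epsilon>" using assms by (auto simp: \<eta>_def)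
  \<comment> \<open>A bound for the modulus of the cosine: 1/2 comes from facing a longest edge, cos
    \<eta> from the distance of the angle to pi. The constant \<open>\<delta>\<close> is the
    corresponding sine.\<close>
  define c where "c = max (1/2) (cos \<eta>)"
  have "cos \<eta> < 1" using cos_monotone_0_pi[of 0 \<eta>] \<eta> pi_gt_zero by auto
  then have c: "1/2 \<le> c" "c < 1" "cos \<eta> \<le> c" by (auto simp: c_def)
  then have c2: "c\<^sup>2 < 1" by (simp add: power_less_one_iff abs_square_less_1)
  define \<delta> where "\<delta> = sqrt (1 - c\<^sup>2)"
  have \<delta>: "0 < \<delta>" "\<delta>\<^sup>2 = 1 - c\<^sup>2" using c2 by (auto simp: \<delta>_def)
  show thesis
  proof (rule that[OF \<delta>(1)])
    fix p
    assume p: "cmod p \<le> cmod (p - 1)" "cmod (p - 1) \<le> 1" "0 \<le> Im p"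
      and angle: "vertex_angle p 0 1 < pi - \<epsilon>"
    show "\<delta> * (cmod p)\<^sup>2 \<le> Im p"
    proof (cases "p = 0")
      \<comment> \<open>Two vertices coincide. Division by zero makes the angle pi / 2 here, and
        both sides of the claim vanish.\<close>
      case True
      then show ?thesis by simp
    next
      case False
      define n where "n = cmod p * cmod (p - 1)"
      define D where "D = (0 - p) \<bullet> (1 - p)"
      have n: "0 < n" using False p(1) by (auto simp: n_def intro!: mult_pos_pos)
      have "cmod p * cmod p \<le> n" unfolding n_def using p(1) by (intro mult_left_mono) auto
      then have pn: "(cmod p)\<^sup>2 \<le> n" by (simp add: power2_eq_square)
      \<comment> \<open>Lagrange's identity for the two sides at \<open>p\<close>, whose cross
        product is Im p up to sign.\<close>
      have n2: "n\<^sup>2 = D\<^sup>2 + (Im p)\<^sup>2"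
        unfolding n_def D_def power_mult_distrib cmod_power2
        by (simp add: inner_complex_def power2_eq_square algebra_simps)
      have angle': "vertex_angle p 0 1 = arccos (D / n)"
        by (simp add: vertex_angle_def D_def n_def norm_minus_commute)
      have "\<bar>D\<bar> \<le> n" by (rule power2_le_imp_le) (use n2 n in auto)
      then have k: "-1 \<le> D / n" "D / n \<le> 1" using n by (auto simp: field_simps)
      have "- c \<le> D / n"
      proof (rule ccontr)
        assume "\<not> - c \<le> D / n"
        then have "D / n \<le> cos (pi - \<eta>)" using c(3) by simp
        then have "arccos (cos (pi - \<eta>)) \<le> arccos (D / n)" using k(1) by (intro arccos_le_arccos) auto
        moreover have "arccos (cos (pi - \<eta>)) = pi - \<eta>" using \<eta> by (intro arccos_cos) auto
        ultimately show False using angle \<eta>(3) unfolding angle' by linarith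
      qed
      \<comment> \<open>The law of cosines, the opposite edge having length 1.\<close>
      moreover have "2 * D = (cmod p)\<^sup>2 + (cmod (p - 1))\<^sup>2 - 1"
        unfolding D_def cmod_power2 by (simp add: inner_complex_def power2_eq_square algebra_simps)
      then have "2 * D \<le> n" using p(2) pn by (smt (verit) norm_ge_zero power_le_one)
      moreover have "1/2 * n \<le> c * n" using c(1) n by (intro mult_right_mono) auto
      moreover from \<open>- c \<le> D / n\<close> have "- c * n \<le> D" using n by (simp add: field_simps)
      ultimately have "- c * n \<le> D" "D \<le> c * n" by linarith+
      then have "\<bar>D\<bar> \<le> c * n" by linarith
      then have "D\<^sup>2 \<le> (c * n)\<^sup>2" using power_mono[of "\<bar>D\<bar>" "c * n" 2] by simp
      then have "(\<delta> * n)\<^sup>2 \<le> (Im p)\<^sup>2"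
        using n2 by (simp add: power_mult_distrib \<delta>(2) algebra_simps)
      then have "\<delta> * n \<le> Im p" using p(3) by (rule power2_le_imp_le)
      moreover have "\<delta> * (cmod p)\<^sup>2 \<le> \<delta> * n" using pn \<delta>(1) by simp
      ultimately show ?thesis by linarith
    qed
  qed
qed

section \<open>Area and nondegeneracy along the chain\<close>

fun dbl_area :: "triangle \<Rightarrow> real" where
  "dbl_area (A, B, C) = \<bar>Im (cnj (B - A) * (C - A))\<bar>"

lemma dbl_area_ordering: "U \<in> orderings T \<Longrightarrow> dbl_area U = dbl_area T"
  by (cases T) (auto simp: orderings_def algebra_simps abs_if)

text \<open>Reduces statements that ignore the order of the vertices to the first child of a
  relabelled parent.\<close>

lemma bary_child_ordering:
  obtains A B C where "(A, B, C) \<in> orderings T"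
    "(A, (A + B) / 2, (A + B + C) / 3) \<in> orderings (bary_child T i)"
proof -
  obtain A B C where T: "T = (A, B, C)" by (cases T)
  note defs = T orderings_def bary_child_def Let_def add_ac
  consider "i = 0" | "i = 1" | "i = 2" | "i = 3" | "i = 4" | "i \<notin> {0, 1, 2, 3, 4}" by blast
  then show thesis
  proof cases
    case 1
    then show thesis by (intro that[of A B C]) (simp_all add: defs)
  next
    case 2
    then show thesis by (intro that[of B A C]) (simp_all add: defs)
  next
    case 3
    then show thesis by (intro that[of B C A]) (simp_all add: defs)
  next
    case 4
    then show thesis by (intro that[of C B A]) (simp_all add: defs)
  next
    case 5
    then show thesis by (intro that[of C A B]) (simp_all add: defs)
  next
    case 6
    then show thesis by (intro that[of A C B]) (simp_all add: defs)
  qed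
qed

lemma dbl_area_bary_child: "dbl_area (bary_child T i) = dbl_area T / 6"
proof -
  obtain A B C where o: "(A, B, C) \<in> orderings T"
    "(A, (A + B) / 2, (A + B + C) / 3) \<in> orderings (bary_child T i)"
    by (rule bary_child_ordering)
  have "Im (cnj ((A + B) / 2 - A) * ((A + B + C) / 3 - A)) = Im (cnj (B - A) * (C - A)) / 6"
    by (simp add: field_simps)
  then have "dbl_area (A, (A + B) / 2, (A + B + C) / 3) = dbl_area (A, B, C) / 6"
    by (simp only: dbl_area.simps abs_divide abs_numeral)
  then show ?thesis using o[THEN dbl_area_ordering] by simp
qed

lemma nondeg_ordering: "U \<in> orderings T \<Longrightarrow> nondeg_triangle U \<longleftrightarrow> nondeg_triangle T"
  by (cases T) (auto simp: orderings_def nondeg_triangle_def)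

lemma nondeg_bary_child:
  assumes "nondeg_triangle T"
  shows "nondeg_triangle (bary_child T i)"
proof -
  obtain A B C where o: "(A, B, C) \<in> orderings T"
    "(A, (A + B) / 2, (A + B + C) / 3) \<in> orderings (bary_child T i)"
    by (rule bary_child_ordering)
  have "A = B \<and> B = C" if "A = (A + B) / 2" "(A + B) / 2 = (A + B + C) / 3"
  proof -
    have AB: "A = B" using that(1) by (simp add: field_simps)
    then have "A + B = 2 * C" using that(2) by (simp add: field_simps)
    then show ?thesis using AB by simp
  qed
  then have "nondeg_triangle (A, B, C) \<Longrightarrow> nondeg_triangle (A, (A + B) / 2, (A + B + C) / 3)"
    unfolding nondeg_triangle_def prod.case by blast
  then show ?thesis using o[THEN nondeg_ordering] assms by blast
qed

lemma set_tri_chain_invariant: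
  assumes "nondeg_triangle T" "U \<in> set_pmf (tri_chain T n)"
  shows "nondeg_triangle U \<and> dbl_area U = dbl_area T / 6 ^ n"
  using assms(2)
proof (induction n arbitrary: U)
  case 0
  then show ?case using assms(1) by simp
next
  case (Suc n)
  then obtain S i where "S \<in> set_pmf (tri_chain T n)" "U = bary_child S i"
    by (auto simp: bary_step_def)
  then show ?case using Suc.IH[of S] by (simp add: nondeg_bary_child dbl_area_bary_child)
qed

text \<open>In the normalized form the base is 1, so Im p is the doubled area; undoing the
  similitude divides it and the squared shortest edge by the same k^2. For area 0 the conclusion
  says that two vertices coincide.\<close>

lemma small_edge_of_angle:
  fixes \<epsilon> :: real
  assumes "0 < \<epsilon>"
  obtains \<delta> :: real where "0 < \<delta>"
    "\<And>T. \<lbrakk>nondeg_triangle T; largest_angle T < pi - \<epsilon>\<rbrakk> \<Longrightarrow>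
       \<exists>P Q R. (P, Q, R) \<in> orderings T \<and> \<delta> * (cmod (R - P))\<^sup>2 \<le> dbl_area T"
proof -
  obtain \<delta> where \<delta>: "0 < \<delta>" and flat:
    "\<And>p. \<lbrakk>cmod p \<le> cmod (p - 1); cmod (p - 1) \<le> 1; 0 \<le> Im p; vertex_angle p 0 1 < pi - \<epsilon>\<rbrakk>
       \<Longrightarrow> \<delta> * (cmod p)\<^sup>2 \<le> Im p"
    using assms by (rule vertex_angle_flat) blast
  show thesis
  proof (rule that[OF \<delta>])
    fix T assume T: "nondeg_triangle T" "largest_angle T < pi - \<epsilon>"
    define p where "p = char_point T"
    obtain P Q R f where o: "(P, Q, R) \<in> orderings T" "dist P Q \<ge> dist Q R" "dist Q R \<ge> dist P R"
      and f: "similitude f" "f P = 0" "f Q = 1" "f R = p" and p: "0 \<le> Im p"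
      using is_char_point_char_point[OF T(1)] unfolding is_char_point_iff p_def by blast
    obtain k where k: "0 < k" "\<And>x y. dist (f x) (f y) = k * dist x y"
      "\<And>x y z. \<bar>Im (cnj (f y - f x) * (f z - f x))\<bar> = k\<^sup>2 * \<bar>Im (cnj (y - x) * (z - x))\<bar>"
      using f(1) by (rule similitude_scale) blast
    have 1: "1 = k * dist P Q" "cmod p = k * dist P R" "cmod (p - 1) = k * dist Q R"
      using k(2)[of P Q] k(2)[of R P] k(2)[of R Q] f
      by (simp_all add: dist_norm norm_minus_commute)
    have "cmod p \<le> cmod (p - 1)" "cmod (p - 1) \<le> 1"
      using o k(1) unfolding 1(2,3) by (simp, subst 1(1), simp)
    then have "\<delta> * (cmod p)\<^sup>2 \<le> Im p"
      using flat p T(2) by (simp add: largest_angle_def p_def)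
    moreover have "Im p = k\<^sup>2 * dbl_area T"
      using k(3)[of Q P R] f p dbl_area_ordering[OF o(1)] by simp
    ultimately have "k\<^sup>2 * (\<delta> * (cmod (R - P))\<^sup>2) \<le> k\<^sup>2 * dbl_area T"
      by (simp add: 1(2) dist_norm norm_minus_commute power_mult_distrib mult_ac)
    then have "\<delta> * (cmod (R - P))\<^sup>2 \<le> dbl_area T" using k(1) by simp
    then show "\<exists>P Q R. (P, Q, R) \<in> orderings T \<and> \<delta> * (cmod (R - P))\<^sup>2 \<le> dbl_area T"
      using o(1) by blast
  qed
qed

text \<open>The permutations of (1, -1, 0) produce the six directed edges, and a sum of nonnegative
  terms dominates each of them.\<close>

lemma sym6_edges_ge_1:
  assumes "(P, Q, R) \<in> orderings T" "h (R - P) = 1" "\<And>z. 0 \<le> h z"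
  shows "1 \<le> sym6 (\<lambda>v. h (comb v T)) (1, - 1, 0)"
proof -
  obtain A B C where T: "T = (A, B, C)" by (cases T)
  have nn: "0 \<le> h (x - y)" "0 \<le> h (- x + y)" for x y using assms(3) by auto
  show ?thesis
    using assms(1,2) nn[of A B] nn[of B A] nn[of A C] nn[of C A] nn[of B C] nn[of C B]
    unfolding T orderings_def by (auto simp: add.commute[of "- _"])
qed

section \<open>Geometric decay\<close>

lemma sym6_le:
  assumes w: "weights w"
    and sym: "\<And>a b c. weights (a, b, c) \<Longrightarrow> V (b, a, c) = V (a, b, c) \<and> V (a, c, b) = V (a, b, c)"
    and le: "\<And>v. weights v \<Longrightarrow> F v \<le> M * V v"
  shows "sym6 F w \<le> 6 * M * V w"
proof -
  obtain a b c where w_eq: "w = (a, b, c)" by (cases w)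
  have wts: "weights (a, b, c)" "weights (a, c, b)" "weights (b, a, c)"
    "weights (b, c, a)" "weights (c, a, b)" "weights (c, b, a)"
    using w by (auto simp: w_eq)
  have V: "V (b, a, c) = V w" "V (a, c, b) = V w" "V (c, a, b) = V w" "V (b, c, a) = V w"
     "V (c, b, a) = V w"
    using sym[OF wts(1)] sym[OF wts(2)] sym[OF wts(3)] sym[OF wts(4)] unfolding w_eq by argo+
  show ?thesis
    using le[OF wts(1)] le[OF wts(2)] le[OF wts(3)] le[OF wts(4)] le[OF wts(5)] le[OF wts(6)]
    unfolding V unfolding w_eq sym6.simps by linarith
qed

text \<open>All vectors that vanish on \<open>T\<close> have one height, so a multiple of its
  negative power dominates the indicator of vanishing, and the contraction of heights
  applies.\<close>

lemma expectation_zero_edge_le: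
  assumes T: "nondeg_triangle T"
  obtains K \<rho> :: real where "0 \<le> \<rho>" "\<rho> < 1"
    "\<And>n. measure_pmf.expectation (tri_chain T n)
        (\<lambda>U. sym6 (\<lambda>v. of_bool (comb v U = 0)) (1, - 1, 0)) \<le> K * \<rho> ^ n"
proof -
  obtain s \<rho> :: real where s: "0 < s" "0 \<le> \<rho>" "\<rho> < 1" and step:
    "\<And>w. weights w \<Longrightarrow> sym6 (\<lambda>v. proj_height (refine v) powr - s) w \<le> 6 * \<rho> * proj_height w powr - s"
    by (rule proj_height_powr_drift) blast
  \<comment> \<open>If no weight vector vanishes on \<open>T\<close>, any value serves as
    \<open>H\<close>.\<close>
  have "\<exists>H. \<forall>v. weights v \<and> comb v T = 0 \<longrightarrow> proj_height v = H"
    using proj_height_eq_if_comb_zero[OF T] by metis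
  then obtain H where H: "\<And>v. weights v \<Longrightarrow> comb v T = 0 \<Longrightarrow> proj_height v = H" by blast
  have base1: "of_bool (comb v T = 0) \<le> H powr s * proj_height v powr - s" if "weights v" for v
  proof (cases "comb v T = 0")
    case True
    then show ?thesis
      using H[OF that True] proj_height_pos[OF that] by (simp add: powr_minus field_simps)
  next
    case False
    then show ?thesis by simp
  qed
  have base: "sym6 (\<lambda>v. of_bool (comb v T = 0)) w \<le> 6 * H powr s * proj_height w powr - s"
    if "weights w" for w
    using that by (rule sym6_le) (use proj_height_sym base1 in auto)
  show thesis
  proof (rule that[OF s(2,3)])
    fix n
    have "measure_pmf.expectation (tri_chain T n)
        (\<lambda>U. sym6 (\<lambda>v. of_bool (6 ^ n * comb v U = 0)) (1, - 1, 0))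
      \<le> 6 * H powr s * \<rho> ^ n * proj_height (1, - 1, 0) powr - s"
      by (rule expectation_tri_chain_sym6_le[where V = "\<lambda>w. proj_height w powr - s"
            and h = "\<lambda>z. of_bool (z = 0)", OF step base]) (use s in auto)
    then show "measure_pmf.expectation (tri_chain T n)
        (\<lambda>U. sym6 (\<lambda>v. of_bool (comb v U = 0)) (1, - 1, 0))
      \<le> (6 * H powr s * proj_height (1, - 1, 0) powr - s) * \<rho> ^ n"
      by (simp add: mult_ac)
  qed
qed

text \<open>A Markov-type bound: a short combination forces \<open>sqnorm\<close> to be at most L /
  k, so the indicator is dominated by a negative power of \<open>sqnorm\<close>. The threshold
  shrinks at the rate of the area.\<close>

lemma expectation_small_edge_le:
  fixes \<kappa> :: real
  assumes T: "dbl_area T \<noteq> 0" and \<kappa>: "0 < \<kappa>"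
  obtains K \<rho> :: real where "0 \<le> \<rho>" "\<rho> < 1"
    "\<And>n. measure_pmf.expectation (tri_chain T n)
        (\<lambda>U. sym6 (\<lambda>v. of_bool ((cmod (comb v U))\<^sup>2 \<le> \<kappa> / 6 ^ n)) (1, - 1, 0)) \<le> K * \<rho> ^ n"
proof -
  obtain s \<rho> :: real where s: "0 < s" "0 \<le> \<rho>" "\<rho> < 1" and step:
    "\<And>w. weights w \<Longrightarrow> sym6 (\<lambda>v. real_of_int (sqnorm (refine v)) powr - s) w
       \<le> 6 * (6 powr - s * \<rho>) * real_of_int (sqnorm w) powr - s"
    by (rule sqnorm_drift) blast
  obtain A B C where T_eq: "T = (A, B, C)" by (cases T)
  have "Im (cnj (B - A) * (C - A)) \<noteq> 0" using T by (simp add: T_eq)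
  then obtain k where k: "0 < k"
    "\<And>w. weights w \<Longrightarrow> k * real_of_int (sqnorm w) \<le> (cmod (comb w T))\<^sup>2"
    unfolding T_eq by (rule sqnorm_le_comb) blast
  have base1: "of_bool ((cmod (comb v T))\<^sup>2 \<le> L) \<le> (L / k) powr s * real_of_int (sqnorm v) powr - s"
    if "weights v" "0 < L" for v L
  proof (cases "(cmod (comb v T))\<^sup>2 \<le> L")
    case True
    have N: "0 < real_of_int (sqnorm v)" using sqnorm_pos[OF that(1)] by (simp only: of_int_0_less_iff)
    have "k * real_of_int (sqnorm v) \<le> L" using k(2)[OF that(1)] True by linarith
    then have "real_of_int (sqnorm v) \<le> L / k" using k(1) by (simp add: field_simps)
    then have "real_of_int (sqnorm v) powr s \<le> (L / k) powr s" using N s(1) by (intro powr_mono2) auto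
    then show ?thesis using N True by (simp add: powr_minus field_simps del: sqnorm.simps)
  next
    case False
    then show ?thesis by simp
  qed
  have base: "sym6 (\<lambda>v. of_bool ((cmod (comb v T))\<^sup>2 \<le> L)) w
      \<le> 6 * (L / k) powr s * real_of_int (sqnorm w) powr - s"
    if "weights w" "0 < L" for w L
    using that(1) by (rule sym6_le) (use base1[OF _ that(2)] in \<open>auto simp: add_ac\<close>)
  define K where "K = 6 * (\<kappa> / k) powr s * real_of_int (sqnorm (1, - 1, 0)) powr - s"
  show thesis
  proof (rule that[OF s(2,3)])
    fix n
    \<comment> \<open>Scaling an edge by 6^n multiplies its square by 6^(2n), so the shrinking
      threshold becomes a growing one.\<close>
    have h: "(cmod (6 ^ n * z))\<^sup>2 \<le> \<kappa> * 6 ^ n \<longleftrightarrow> (cmod z)\<^sup>2 \<le> \<kappa> / 6 ^ n" for z :: complex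
      by (simp add: norm_mult norm_power power_mult_distrib power2_eq_square field_simps)
    have "(6 ^ n) powr s = (6 powr s) ^ n" for n :: nat
      by (induction n) (auto simp: powr_mult)
    \<comment> \<open>The growth of the threshold is cancelled exactly by the factor 6 powr -s that
      each step contributes; only \<open>\<rho>\<close> ^ n survives.\<close>
    then have cancel: "(\<kappa> * 6 ^ n / k) powr s * (6 powr - s * \<rho>) ^ n = (\<kappa> / k) powr s * \<rho> ^ n"
      using \<kappa> k(1) by (simp add: powr_divide powr_mult powr_minus power_mult_distrib power_inverse field_simps)
    have "measure_pmf.expectation (tri_chain T n)
        (\<lambda>U. sym6 (\<lambda>v. of_bool ((cmod (6 ^ n * comb v U))\<^sup>2 \<le> \<kappa> * 6 ^ n)) (1, - 1, 0))
      \<le> 6 * (\<kappa> * 6 ^ n / k) powr s * (6 powr - s * \<rho>) ^ n * real_of_int (sqnorm (1, - 1, 0)) powr - s"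
      by (rule expectation_tri_chain_sym6_le[where V = "\<lambda>w. real_of_int (sqnorm w) powr - s"
            and h = "\<lambda>z. of_bool ((cmod z)\<^sup>2 \<le> \<kappa> * 6 ^ n)", OF step base]) (use s \<kappa> in auto)
    also have "\<dots> = K * \<rho> ^ n"
      unfolding K_def mult.assoc[of 6 _ "(6 powr - s * \<rho>) ^ n"] cancel by simp
    finally show "measure_pmf.expectation (tri_chain T n)
        (\<lambda>U. sym6 (\<lambda>v. of_bool ((cmod (comb v U))\<^sup>2 \<le> \<kappa> / 6 ^ n)) (1, - 1, 0)) \<le> K * \<rho> ^ n"
      unfolding h .
  qed
qed

lemma prob_tri_chain_le_expectation:
  assumes "\<And>U. U \<in> set_pmf (tri_chain T n) \<Longrightarrow> U \<in> S \<Longrightarrow> 1 \<le> F U" and "\<And>U. 0 \<le> F U"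
  shows "measure_pmf.prob (tri_chain T n) S \<le> measure_pmf.expectation (tri_chain T n) F"
proof -
  have "measure_pmf.prob (tri_chain T n) S = measure_pmf.expectation (tri_chain T n) (indicator S)"
    by simp
  also have "\<dots> \<le> measure_pmf.expectation (tri_chain T n) F"
    by (intro integral_mono_AE integrable_measure_pmf_finite finite_set_tri_chain)
       (use assms in \<open>auto simp: AE_measure_pmf_iff indicator_def\<close>)
  finally show ?thesis .
qed

lemma sym6_nonneg: "(\<And>v. 0 \<le> F v) \<Longrightarrow> 0 \<le> sym6 F w"
  by (cases w) (auto intro!: add_nonneg_nonneg)

theorem theorem2:
  fixes T0 :: triangle and \<epsilon> :: real
  assumes "nondeg_triangle T0" and "\<epsilon> > 0"
  shows "(\<lambda>n. measure_pmf.prob (tri_chain T0 n) {T. largest_angle T < pi - \<epsilon>})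
           \<longlonglongrightarrow> 0"
proof -
  obtain \<delta> where \<delta>: "0 < \<delta>" and edge:
    "\<And>T. \<lbrakk>nondeg_triangle T; largest_angle T < pi - \<epsilon>\<rbrakk> \<Longrightarrow>
       \<exists>P Q R. (P, Q, R) \<in> orderings T \<and> \<delta> * (cmod (R - P))\<^sup>2 \<le> dbl_area T"
    using assms(2) by (rule small_edge_of_angle) blast
  let ?S = "{T. largest_angle T < pi - \<epsilon>}"
  have "\<exists>K \<rho>. 0 \<le> \<rho> \<and> \<rho> < 1 \<and> (\<forall>n. measure_pmf.prob (tri_chain T0 n) ?S \<le> K * \<rho> ^ n)"
  \<comment> \<open>A flat start stays flat, so the event needs two coinciding vertices; otherwise
    it needs an edge that is short compared with the known area.\<close>
  proof (cases "dbl_area T0 = 0")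
    case True
    obtain K \<rho> :: real where \<rho>: "0 \<le> \<rho>" "\<rho> < 1" and K: "\<And>n. measure_pmf.expectation (tri_chain T0 n)
        (\<lambda>U. sym6 (\<lambda>v. of_bool (comb v U = 0)) (1, - 1, 0)) \<le> K * \<rho> ^ n"
      using assms(1) by (rule expectation_zero_edge_le) blast
    have "measure_pmf.prob (tri_chain T0 n) ?S \<le> K * \<rho> ^ n" for n
    proof (rule order_trans[OF prob_tri_chain_le_expectation K])
      fix U assume U: "U \<in> set_pmf (tri_chain T0 n)" "U \<in> ?S"
      have inv: "nondeg_triangle U" "dbl_area U = 0"
        using set_tri_chain_invariant[OF assms(1) U(1)] True by auto
      obtain P Q R where P: "(P, Q, R) \<in> orderings U" "\<delta> * (cmod (R - P))\<^sup>2 \<le> 0"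
        using edge[OF inv(1)] U(2) inv(2) by auto
      then have "R - P = 0" using \<delta> by (simp add: mult_le_0_iff)
      then show "1 \<le> sym6 (\<lambda>v. of_bool (comb v U = 0)) (1, - 1, 0)"
        by (intro sym6_edges_ge_1[OF P(1), where h = "\<lambda>z. of_bool (z = 0)"]) auto
    qed (auto intro!: sym6_nonneg)
    then show ?thesis using \<rho> by blast
  next
    case False
    \<comment> \<open>The area at time n is that of \<open>T0\<close> divided by 6^n, so
      \<open>edge\<close> bounds some squared edge by \<kappa> / 6^n.\<close>
    define \<kappa> where "\<kappa> = dbl_area T0 / \<delta>"
    have "0 \<le> dbl_area T0" by (cases T0) simp
    then have "0 < \<kappa>" using False \<delta> by (simp add: \<kappa>_def)
    obtain K \<rho> :: real where \<rho>: "0 \<le> \<rho>" "\<rho> < 1" and K: "\<And>n. measure_pmf.expectation (tri_chain T0 n)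
        (\<lambda>U. sym6 (\<lambda>v. of_bool ((cmod (comb v U))\<^sup>2 \<le> \<kappa> / 6 ^ n)) (1, - 1, 0)) \<le> K * \<rho> ^ n"
      using False \<open>0 < \<kappa>\<close> by (rule expectation_small_edge_le) blast
    have "measure_pmf.prob (tri_chain T0 n) ?S \<le> K * \<rho> ^ n" for n
    proof (rule order_trans[OF prob_tri_chain_le_expectation K])
      fix U assume U: "U \<in> set_pmf (tri_chain T0 n)" "U \<in> ?S"
      have inv: "nondeg_triangle U" "dbl_area U = dbl_area T0 / 6 ^ n"
        using set_tri_chain_invariant[OF assms(1) U(1)] by auto
      obtain P Q R where P: "(P, Q, R) \<in> orderings U" "\<delta> * (cmod (R - P))\<^sup>2 \<le> dbl_area T0 / 6 ^ n"
        using edge[OF inv(1)] U(2) inv(2) by auto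
      then have "(cmod (R - P))\<^sup>2 \<le> \<kappa> / 6 ^ n" using \<delta> by (simp add: \<kappa>_def field_simps)
      then show "1 \<le> sym6 (\<lambda>v. of_bool ((cmod (comb v U))\<^sup>2 \<le> \<kappa> / 6 ^ n)) (1, - 1, 0)"
        by (intro sym6_edges_ge_1[OF P(1), where h = "\<lambda>z. of_bool ((cmod z)\<^sup>2 \<le> \<kappa> / 6 ^ n)"]) auto
    qed (auto intro!: sym6_nonneg)
    then show ?thesis using \<rho> by blast
  qed
  then obtain K \<rho> :: real where \<rho>: "0 \<le> \<rho>" "\<rho> < 1"
    and K: "\<And>n. measure_pmf.prob (tri_chain T0 n) ?S \<le> K * \<rho> ^ n" by blast
  have "(\<lambda>n. K * \<rho> ^ n) \<longlonglongrightarrow> 0"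
    using tendsto_mult_right_zero[OF LIMSEQ_realpow_zero[OF \<rho>]] by simp
  then show ?thesis
    by (rule tendsto_sandwich[OF _ _ tendsto_const, rotated 2]) (use K in auto)
qed

end
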